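(* Let $f\colon\mathbb T\to\mathbb R$ and $h\colon\mathbb T^2\to\mathbb R$ be Lipschitz, let $p$ be a probability density on $[0,1]$, extended $1$-periodically to $\mathbb R$, and let $c>0$ be such that $p(x)>c$ for all $x\in[0,1]$. Assume $$\kappa:=(1-c)\left(\operatorname{Lip}(f)+\operatorname{Lip}_1(h)+\operatorname{Lip}_2(h)\right)<\frac{\sqrt3}{2}.$$ Let $$\mathcal P_N(\mu)(dx)=\int_{\mathbb T^N}\prod_{j=1}^N p\Big(x_j-f(u_j)-\frac1N\sum_{k=1}^N h(u_j,u_k)\Big)dx_j\,d\mu(u),\qquad \mu\in\mathcal M_1(\mathbb T^N),$$ and $$\mathcal P(\nu)(dx)=\int_{\mathbb T}p\Big(x-f(u)-\int_{\mathbb T} h(u,v)\,d\nu(v)\Big)dx\,d\nu(u),\qquad\nu\in\mathcal M_1(\mathbb T).$$ Then: 1. There exists a constant $\bar C_0>0$ such that for every $N\ge2$, every exchangeable $\mu\in\mathcal M_1(\mathbb T^N)$ and every $n\ge0$, $$W^1_N\left(\mathcal P_N^n(\mu),(\mathcal P^n(\pi_1\mu))^{\otimes N}\right)\le\kappa^n\,W^1_N\left(\mu,(\pi_1\mu)^{\otimes N}\right)+\bar C_0N^{-1/2}.$$ 2. If in addition $p\in\operatorname{BV}(\mathbb T)$, then for every $k\ge1$ there exist constants $\bar C_{0,k},\bar C_{1,k}>0$ such that for every $N\ge2$ with $N\ge k$, every exchangeable $\mu\in\mathcal M_1(\mathbb T^N)$ and every $n\ge1$, $$\left\|\pi_{\{1,\dots,k\}}\mathcal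 P_N^n(\mu)-(\mathcal P^n(\pi_1\mu))^{\otimes k}\right\|_{TV}\le\bar C_{0,k}\,\kappa^{n-1}\,W^1_N\left(\mu,(\pi_1\mu)^{\otimes N}\right)+\bar C_{1,k}N^{-1/2}.$$
   Context: $\mathbb T=\mathbb R/\mathbb Z$ with the arc-length distance $d$ (so $d(x,y)=\min_{m\in\mathbb Z}|x-y-m|$), and $\mathcal M_1(X)$ is the set of Borel probability measures on $X$. $\operatorname{Lip}(f)$ is the Lipschitz constant of $f$ with respect to $d$. $\operatorname{Lip}_1(h)=\sup_{u_1\ne u_1',\,u_2}\frac{|h(u_1,u_2)-h(u_1',u_2)|}{d(u_1,u_1')}$, and $\operatorname{Lip}_2(h)$ is defined analogously in the second variable. $\mathcal P_N$ is the transfer operator of the Markov chain $x_i^{n+1}=f(x_i^n)+\frac1N\sum_{j=1}^N h(x_i^n,x_j^n)+\omega_i^n \bmod 1$, $i=1,\dots,N$, where the $\omega_i^n$ are i.i.d. with density $p$; $\mathcal P$ is the associated self-consistent transfer operator. Superscript $n$ denotes $n$-fold iteration. For $g\colon\mathbb T^N\to\mathbb R$ and $1\le i\le N$, $$\operatorname{Lip}_i(g)=\sup_{x_{-i}\in\mathbb T^{N-1}}\sup_{x_i\ne x_i'}\frac{|g(x_i,x_{-i})-g(x_i',x_{-i})|}{d(x_i,x_i')},$$ where $x_{-i}$ is the vector of the coordinates other than the $i$-th; and $\operatorname{Lip}^N(g)=\sum_{i=1}^N\operatorname{Lip}_i(g)$. The $N$-dimensional Dobrushin-Wasserstein distance on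 $\mathcal M_1(\mathbb T^N)$ is $$W^1_N(\mu_1,\mu_2)=\sup_{g\colon\mathbb T^N\to\mathbb R,\ \operatorname{Lip}^N(g)\le1}\int g\,d(\mu_1-\mu_2).$$ A measure $\mu\in\mathcal M_1(\mathbb T^N)$ is exchangeable if it is invariant under all permutations of the coordinates: $\int g(x_1,\dots,x_N)\,d\mu=\int g(x_{\sigma(1)},\dots,x_{\sigma(N)})\,d\mu$ for every permutation $\sigma$ of $\{1,\dots,N\}$ and every bounded measurable $g$. $\pi_{\{1,\dots,k\}}\mu\in\mathcal M_1(\mathbb T^k)$ denotes the marginal of $\mu$ on the first $k$ coordinates, and $\pi_1\mu\in\mathcal M_1(\mathbb T)$ the marginal on the first coordinate. $\|\cdot\|_{TV}$ is the total variation norm, and $\operatorname{BV}(\mathbb T)$ is the space of functions of bounded variation on $\mathbb T$. *)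

theory Defs
  imports "HOL-Probability.Probability"
begin

quotient_type circle = real / "\<lambda>x y::real. x - y \<in> \<int>"
  morphisms rep_circle to_circle
proof (rule equivpI)
  show "reflp (\<lambda>x y::real. x - y \<in> \<int>)"
    by (auto intro: reflpI)
  show "symp (\<lambda>x y::real. x - y \<in> \<int>)"
    by (rule sympI) (metis Ints_minus minus_diff_eq)
  show "transp (\<lambda>x y::real. x - y \<in> \<int>)"
    by (rule transpI) (metis Ints_add diff_add_cancel add_diff_eq)
qed

lemma INF_int_dist:
  fixes z :: real
  shows "(INF m::int. \<bar>z - of_int m\<bar>) = \<bar>z - of_int (round z)\<bar>"
proof (rule antisym)
  have "bdd_below (range (\<lambda>m::int. \<bar>z - of_int m\<bar>))"
    by (rule bdd_belowI[of _ 0]) auto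
  then show "(INF m::int. \<bar>z - of_int m\<bar>) \<le> \<bar>z - of_int (round z)\<bar>"
    by (rule cINF_lower) simp
  show "\<bar>z - of_int (round z)\<bar> \<le> (INF m::int. \<bar>z - of_int m\<bar>)"
    by (rule cINF_greatest) (auto intro: round_diff_minimal)
qed

instantiation circle :: metric_space
begin

lift_definition dist_circle :: "circle \<Rightarrow> circle \<Rightarrow> real"
  is "\<lambda>x y. INF m::int. \<bar>x - y - of_int m\<bar>"
proof -
  fix x x' y y' :: real
  assume "x - x' \<in> \<int>" "y - y' \<in> \<int>"
  then have "(x - y) - (x' - y') \<in> \<int>"
    by (metis Ints_diff diff_diff_eq2 add_diff_eq diff_add_eq diff_diff_eq add.commute)
  then obtain k :: int where k: "x - y = x' - y' + of_int k"
    by (metis Ints_cases diff_eq_eq add.commute)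
  have "range (\<lambda>m::int. \<bar>x - y - of_int m\<bar>) = range (\<lambda>m::int. \<bar>x' - y' - of_int m\<bar>)"
  proof (intro equalityI subsetI)
    fix t assume "t \<in> range (\<lambda>m::int. \<bar>x - y - of_int m\<bar>)"
    then obtain m :: int where "t = \<bar>x - y - of_int m\<bar>" by auto
    then have "t = \<bar>x' - y' - of_int (m - k)\<bar>" by (simp add: k algebra_simps)
    then show "t \<in> range (\<lambda>m::int. \<bar>x' - y' - of_int m\<bar>)" by blast
  next
    fix t assume "t \<in> range (\<lambda>m::int. \<bar>x' - y' - of_int m\<bar>)"
    then obtain m :: int where "t = \<bar>x' - y' - of_int m\<bar>" by auto
    then have "t = \<bar>x - y - of_int (m + k)\<bar>" by (simp add: k algebra_simps)
    then show "t \<in> range (\<lambda>m::int. \<bar>x - y - of_int m\<bar>)" by blast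
  qed
  then show "(INF m::int. \<bar>x - y - of_int m\<bar>) = (INF m::int. \<bar>x' - y' - of_int m\<bar>)"
    by simp
qed

definition uniformity_circle :: "(circle \<times> circle) filter"
  where "uniformity_circle = (INF e\<in>{0<..}. principal {(x, y). dist x y < e})"

definition open_circle :: "circle set \<Rightarrow> bool"
  where "open_circle U \<longleftrightarrow> (\<forall>x\<in>U. \<forall>\<^sub>F (x', y) in uniformity. x' = x \<longrightarrow> y \<in> U)"

instance
proof
  show "dist x y = 0 \<longleftrightarrow> x = y" for x y :: circle
  proof transfer
    fix x y :: real
    show "(INF m::int. \<bar>x - y - of_int m\<bar>) = 0 \<longleftrightarrow> x - y \<in> \<int>"
      unfolding INF_int_dist by (metis Ints_cases Ints_of_int abs_zero abs_eq_0 eq_iff_diff_eq_0 round_of_int)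
  qed
  show "dist x y \<le> dist x z + dist y z" for x y z :: circle
  proof transfer
    fix x y z :: real
    have "\<bar>(x - y) - of_int (round (x - y))\<bar> \<le> \<bar>(x - y) - of_int (round (x - z) - round (y - z))\<bar>"
      by (rule round_diff_minimal)
    also have "\<dots> \<le> \<bar>x - z - of_int (round (x - z))\<bar> + \<bar>y - z - of_int (round (y - z))\<bar>"
      by simp
    finally show "(INF m::int. \<bar>x - y - of_int m\<bar>)
        \<le> (INF m::int. \<bar>x - z - of_int m\<bar>) + (INF m::int. \<bar>y - z - of_int m\<bar>)"
      unfolding INF_int_dist .
  qed
qed (rule uniformity_circle_def open_circle_def)+

end

text \<open>The representative in \<open>[0, 1)\<close>. It is only ever used as an argument of a
  \<open>1\<close>-periodic function, so the choice of the fundamental domain is immaterial.\<close>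

lift_definition circle_coord :: "circle \<Rightarrow> real" is "frac :: real \<Rightarrow> real"
proof -
  fix x y :: real
  assume "x - y \<in> \<int>"
  then obtain k :: int where "x = y + of_int k"
    by (metis Ints_cases diff_eq_eq add.commute)
  then show "frac x = frac y" by (simp add: frac_def)
qed

definition circle_lebesgue :: "circle measure"
  where "circle_lebesgue = distr (restrict_space lborel {0..<1}) borel to_circle"

text \<open>Points of \<open>\<T>\<^sup>N\<close> are the functions in \<open>{1..N} \<rightarrow>\<^sub>E UNIV\<close>. As the circle
  is second countable, the product sigma-algebra is the Borel sigma-algebra of \<open>\<T>\<^sup>N\<close>.\<close>

abbreviation torus :: "nat \<Rightarrow> (nat \<Rightarrow> circle) measure"
  where "torus N \<equiv> PiM {1..N} (\<lambda>_. borel)"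

abbreviation torus_lebesgue :: "nat \<Rightarrow> (nat \<Rightarrow> circle) measure"
  where "torus_lebesgue N \<equiv> PiM {1..N} (\<lambda>_. circle_lebesgue)"

abbreviation power_measure :: "circle measure \<Rightarrow> nat \<Rightarrow> (nat \<Rightarrow> circle) measure"
  where "power_measure \<nu> N \<equiv> PiM {1..N} (\<lambda>_. \<nu>)"

definition marginal :: "nat \<Rightarrow> (nat \<Rightarrow> circle) measure \<Rightarrow> (nat \<Rightarrow> circle) measure"
  where "marginal k \<mu> = distr \<mu> (torus k) (\<lambda>x. restrict x {1..k})"

definition first_marginal :: "(nat \<Rightarrow> circle) measure \<Rightarrow> circle measure"
  where "first_marginal \<mu> = distr \<mu> borel (\<lambda>x. x 1)"

definition exchangeable :: "nat \<Rightarrow> (nat \<Rightarrow> circle) measure \<Rightarrow> bool"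
  where "exchangeable N \<mu> \<longleftrightarrow>
    (\<forall>\<sigma>. \<sigma> permutes {1..N} \<longrightarrow>
      (\<forall>g \<in> borel_measurable (torus N). bounded (g ` space (torus N)) \<longrightarrow>
        (\<integral>x. (g x :: real) \<partial>\<mu>) = (\<integral>x. g (\<lambda>i. x (\<sigma> i)) \<partial>\<mu>)))"

text \<open>The total variation norm \<open>\<bar>\<mu>\<^sub>1 - \<mu>\<^sub>2\<bar>(X)\<close> of the signed measure
  \<open>\<mu>\<^sub>1 - \<mu>\<^sub>2\<close>, for finite measures on the same sigma-algebra.\<close>

definition tv_norm_diff :: "'a measure \<Rightarrow> 'a measure \<Rightarrow> real"
  where "tv_norm_diff \<mu>\<^sub>1 \<mu>\<^sub>2 =
    (SUP P \<in> {P. finite P \<and> P \<subseteq> sets \<mu>\<^sub>1 \<and> partition_on (space \<mu>\<^sub>1) P}.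
      \<Sum>A\<in>P. \<bar>measure \<mu>\<^sub>1 A - measure \<mu>\<^sub>2 A\<bar>)"

text \<open>The first three constants are meant for Lipschitz functions, whose difference
  quotients are bounded. The constants of test functions on \<open>\<T>\<^sup>N\<close> may be infinite.\<close>

definition Lip :: "(circle \<Rightarrow> real) \<Rightarrow> real"
  where "Lip f = (SUP (u, u') \<in> {(u, u'). u \<noteq> u'}. \<bar>f u - f u'\<bar> / dist u u')"

definition Lip1 :: "(circle \<times> circle \<Rightarrow> real) \<Rightarrow> real"
  where "Lip1 h = (SUP (u, u', v) \<in> {(u, u', v). u \<noteq> u'}. \<bar>h (u, v) - h (u', v)\<bar> / dist u u')"

definition Lip2 :: "(circle \<times> circle \<Rightarrow> real) \<Rightarrow> real"
  where "Lip2 h = (SUP (v, u, u') \<in> {(v, u, u'). u \<noteq> u'}. \<bar>h (v, u) - h (v, u')\<bar> / dist u u')"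

definition Lip_coord :: "nat \<Rightarrow> nat \<Rightarrow> ((nat \<Rightarrow> circle) \<Rightarrow> real) \<Rightarrow> ennreal"
  where "Lip_coord N i g =
    (SUP (x, y) \<in> {(x, y). x \<in> {1..N} \<rightarrow>\<^sub>E UNIV \<and> x i \<noteq> y}.
      ennreal (\<bar>g x - g (x(i := y))\<bar> / dist (x i) y))"

definition LipN :: "nat \<Rightarrow> ((nat \<Rightarrow> circle) \<Rightarrow> real) \<Rightarrow> ennreal"
  where "LipN N g = (\<Sum>i=1..N. Lip_coord N i g)"

text \<open>For probability measures on \<open>\<T>\<^sup>N\<close> the supremum is taken over a bounded set,
  because an admissible \<open>g\<close> is continuous with oscillation at most \<open>1/2\<close>.\<close>

definition W1 :: "nat \<Rightarrow> (nat \<Rightarrow> circle) measure \<Rightarrow> (nat \<Rightarrow> circle) measure \<Rightarrow> real"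
  where "W1 N \<mu>\<^sub>1 \<mu>\<^sub>2 = (SUP g \<in> {g. LipN N g \<le> 1}. (\<integral>x. g x \<partial>\<mu>\<^sub>1) - (\<integral>x. g x \<partial>\<mu>\<^sub>2))"

definition periodic_density :: "(real \<Rightarrow> real) \<Rightarrow> bool"
  where "periodic_density p \<longleftrightarrow>
    p \<in> borel_measurable borel \<and> (\<forall>x. 0 \<le> p x) \<and> (\<forall>x. p (x + 1) = p x) \<and>
    (\<integral>\<^sup>+x\<in>{0..1}. ennreal (p x) \<partial>lborel) = 1"

text \<open>Bounded variation on the circle of a \<open>1\<close>-periodic function: its variation over one
  period is finite.\<close>

definition bv_circle :: "(real \<Rightarrow> real) \<Rightarrow> bool"
  where "bv_circle p \<longleftrightarrow>
    (\<exists>V. \<forall>(n::nat) (t :: nat \<Rightarrow> real). mono_on {..n} t \<and> t ` {..n} \<subseteq> {0..1} \<longrightarrow>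
      (\<Sum>i<n. \<bar>p (t (Suc i)) - p (t i)\<bar>) \<le> V)"

definition transfer_N ::
    "(circle \<Rightarrow> real) \<Rightarrow> (circle \<times> circle \<Rightarrow> real) \<Rightarrow> (real \<Rightarrow> real) \<Rightarrow> nat \<Rightarrow>
      (nat \<Rightarrow> circle) measure \<Rightarrow> (nat \<Rightarrow> circle) measure"
  where "transfer_N f h p N \<mu> =
    density (torus_lebesgue N)
      (\<lambda>x. \<integral>\<^sup>+u. (\<Prod>j=1..N. ennreal (p (circle_coord (x j) - f (u j)
              - 1 / real N * (\<Sum>k=1..N. h (u j, u k))))) \<partial>\<mu>)"

definition transfer_self_consistent ::
    "(circle \<Rightarrow> real) \<Rightarrow> (circle \<times> circle \<Rightarrow> real) \<Rightarrow> (real \<Rightarrow> real) \<Rightarrow>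
      circle measure \<Rightarrow> circle measure"
  where "transfer_self_consistent f h p \<nu> =
    density circle_lebesgue
      (\<lambda>x. \<integral>\<^sup>+u. ennreal (p (circle_coord x - f u - (\<integral>v. h (u, v) \<partial>\<nu>))) \<partial>\<nu>)"

end

theory Submission
  imports Defs
begin

text \<open>Given the configuration \<open>u\<close>, the new coordinates are independent and the \<open>j\<close>-th one has
  density \<open>p(x - a)\<close>, where \<open>a\<close> is the drift of \<open>u\<close> at \<open>j\<close>. Since \<open>p - c\<close> has mass \<open>1 - c\<close>, a change of
  \<open>a\<close> by \<open>\<delta>\<close> changes the expectation of an \<open>L\<close>-Lipschitz function by at most \<open>(1 - c) L \<delta>\<close>, so the
  adjoint of \<open>transfer_N\<close> contracts \<open>LipN\<close> by the factor \<open>\<kappa>\<close>. The product measure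
  \<open>(\<P> \<nu>)\<^sup>N\<close> is obtained from \<open>\<nu>\<^sup>N\<close> by the same mechanism with the averaged drift, and under
  \<open>\<nu>\<^sup>N\<close> the two drifts differ by \<open>O(1 / sqrt N)\<close> in mean, because the deviations are uncorrelated.
  Hence the distances satisfy \<open>W\<^sub>n\<^sub>+\<^sub>1 \<le> \<kappa> W\<^sub>n + O(1 / sqrt N)\<close>. For \<open>p\<close> of bounded variation the same step
  applies to merely bounded test functions of the first \<open>k\<close> coordinates, with the variation in place
  of \<open>(1 - c) L\<close>, which gives the bound in total variation after one more iteration.\<close>

text \<open>The difficulty is uniformity in \<open>N\<close>. Moving \<open>u i\<close> changes the
  drift of every coordinate, but with weight \<open>L2 / N\<close> in each of the \<open>N\<close>
  drifts and weight \<open>Lf + L1\<close> only in its own. Because \<open>LipN\<close> is a sum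
  over coordinates, these weights add up to \<open>Lf + L1 + L2\<close>, free of \<open>N\<close>.
  The law of large numbers cannot be applied under an arbitrary \<mu>. Hence the image of the power
  of \<nu> under the finite system is inserted between the two measures: one difference is then a
  single Lipschitz function integrated against \<mu> and against the power of \<nu>, which
  \<open>W1\<close> controls, and the other compares two drifts under a product measure. Both
  assertions share this step, because a test function enters it only through numbers
  \<open>E j\<close> that say how its average over the noise in coordinate \<open>j\<close> reacts
  to a shift of that noise. The errors of the successive steps form a geometric series, which
  contributes the factor \<open>1 / (1 - \<kappa>)\<close>.\<close>

lemma (in prob_space) integrable_bounded:
  fixes g :: "'a \<Rightarrow> real"
  assumes "g \<in> borel_measurable M" "\<And>x. x \<in> space M \<Longrightarrow> \<bar>g x\<bar> \<le> B"
  shows "integrable M g"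
  using assms by (intro integrable_const_bound[where B=B] AE_I2) auto

lemma (in prob_space) abs_integral_le_bound:
  fixes g :: "'a \<Rightarrow> real"
  assumes "g \<in> borel_measurable M" "\<And>x. x \<in> space M \<Longrightarrow> \<bar>g x\<bar> \<le> B"
  shows "\<bar>\<integral>x. g x \<partial>M\<bar> \<le> B"
proof -
  have "\<bar>\<integral>x. g x \<partial>M\<bar> \<le> (\<integral>x. \<bar>g x\<bar> \<partial>M)"
    by (rule integral_abs_bound)
  also have "\<dots> \<le> (\<integral>x. B \<partial>M)"
    using integrable_bounded[OF assms] by (intro integral_mono assms integrable_abs) auto
  finally show ?thesis by (simp add: prob_space)
qed

section \<open>The circle and its Lebesgue measure\<close>

lemma dist_to_circle_le: "dist (to_circle x) (to_circle y) \<le> \<bar>x - y\<bar>"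
proof -
  have "(INF m::int. \<bar>x - y - of_int m\<bar>) \<le> \<bar>x - y - of_int 0\<bar>"
    by (intro cINF_lower bdd_belowI[of _ 0]) auto
  then show ?thesis by (simp add: dist_circle.abs_eq)
qed

lemma to_circle_surj: "\<exists>y\<in>{0..<1}. to_circle y = u"
proof (induct u rule: circle.abs_induct)
  fix y
  have "to_circle (frac y) = to_circle y"
    by (simp add: circle.abs_eq_iff frac_def)
  then show "\<exists>z\<in>{0..<1}. to_circle z = to_circle y"
    using frac_ge_0 frac_lt_1 by (intro bexI[of _ "frac y"]) auto
qed

lemma dist_circle_le_half: "dist (x::circle) y \<le> 1 / 2"
proof (induct x rule: circle.abs_induct, induct y rule: circle.abs_induct)
  fix x y
  show "dist (to_circle y) (to_circle x) \<le> 1 / 2"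
    unfolding dist_circle.abs_eq INF_int_dist
    using of_int_round_abs_le[of "y - x"] by linarith
qed

lemma to_circle_eq_iff: "to_circle x = to_circle y \<longleftrightarrow> x - y \<in> \<int>"
  by (simp add: circle.abs_eq_iff)

lemma continuous_on_to_circle: "continuous_on A to_circle"
  unfolding continuous_on_iff
  by (metis dist_real_def dist_to_circle_le le_less_trans)

lemma measurable_to_circle [measurable]: "to_circle \<in> borel_measurable borel"
  by (intro borel_measurable_continuous_onI continuous_on_to_circle)

text \<open>Needed so that the product sigma-algebras are the Borel ones (\<open>borel_prod\<close>,
  \<open>sets_PiM_equal_borel\<close>), which makes continuous functions on product spaces
  measurable. The basis consists of balls with rational centres and radii
  \<open>1 / Suc n\<close>.\<close>

instance circle :: second_countable_topology
proof
  define B where "B = (\<lambda>(q, n). ball (to_circle (of_rat q)) (1 / real (Suc n))) ` UNIV"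
  have "topological_basis B"
  proof (rule topological_basisI)
    fix U and u :: circle
    assume "open U" "u \<in> U"
    then obtain e where e: "e > 0" "ball u e \<subseteq> U"
      using open_contains_ball by blast
    obtain n where n: "1 / real (Suc n) < e / 2"
      using e(1) nat_approx_posE[of "e / 2"] by auto
    obtain y where y: "u = to_circle y" using to_circle_surj by metis
    obtain r where r: "r \<in> \<rat>" "y < r" "r < y + 1 / real (Suc n)"
      using Rats_dense_in_real[of y "y + 1 / real (Suc n)"] by auto
    then obtain q where q: "r = of_rat q" by (auto elim: Rats_cases)
    have d: "dist (to_circle r) u < 1 / real (Suc n)"
      using dist_to_circle_le[of r y] r unfolding y by linarith
    have "ball (to_circle r) (1 / real (Suc n)) \<subseteq> ball u e"
    proof
      fix v assume "v \<in> ball (to_circle r) (1 / real (Suc n))"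
      then have "dist (to_circle r) v < 1 / real (Suc n)" by simp
      then have "dist u v < e"
        using d n dist_triangle[of u v "to_circle r"] by (simp add: dist_commute)
      then show "v \<in> ball u e" by simp
    qed
    then show "\<exists>B'\<in>B. u \<in> B' \<and> B' \<subseteq> U"
      using e d unfolding B_def q
      by (intro bexI[of _ "ball (to_circle (of_rat q)) (1 / real (Suc n))"]) auto
  qed (auto simp: B_def)
  then show "\<exists>B::circle set set. countable B \<and> open = generate_topology B"
    by (intro exI[of _ B]) (auto simp: B_def topological_basis_imp_subbasis)
qed

lemma circle_coord_to_circle: "circle_coord (to_circle y) = frac y"
  by (rule circle_coord.abs_eq)

lemma measurable_circle_coord [measurable]: "circle_coord \<in> borel_measurable borel"
proof (rule borel_measurableI_le)
  fix a :: real
  consider "a < 0" | "a \<ge> 1" | "0 \<le> a" "a < 1" by linarith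
  then show "{x \<in> space borel. circle_coord x \<le> a} \<in> sets borel"
  proof cases
    case 1
    have "\<not> circle_coord x \<le> a" for x
      using to_circle_surj[of x] frac_ge_0 1
      by (metis circle_coord_to_circle dual_order.trans not_less)
    then show ?thesis by simp
  next
    case 2
    have "circle_coord x \<le> a" for x
      using to_circle_surj[of x] frac_lt_1 2
      by (metis circle_coord_to_circle dual_order.trans less_imp_le)
    then show ?thesis by simp
  next
    case 3
    have "{x. circle_coord x \<le> a} = to_circle ` {0..a}"
    proof (intro equalityI subsetI)
      fix x assume *: "x \<in> {x. circle_coord x \<le> a}"
      obtain y where "y \<in> {0..<1}" "x = to_circle y" using to_circle_surj by metis
      then show "x \<in> to_circle ` {0..a}"
        using * by (auto simp: circle_coord_to_circle frac_eq)
    next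
      fix x assume "x \<in> to_circle ` {0..a}"
      then show "x \<in> {x. circle_coord x \<le> a}"
        using 3 by (auto simp: circle_coord_to_circle)
    qed
    moreover have "compact (to_circle ` {0..a})"
      by (intro compact_continuous_image continuous_on_to_circle) simp
    ultimately show ?thesis
      by (simp add: compact_imp_closed)
  qed
qed

lemma nn_integral_circle_lebesgue:
  assumes [measurable]: "G \<in> borel_measurable borel"
  shows "(\<integral>\<^sup>+x. G x \<partial>circle_lebesgue) = (\<integral>\<^sup>+y\<in>{0..<1}. G (to_circle y) \<partial>lborel)"
  unfolding circle_lebesgue_def
  by (subst nn_integral_distr) (auto simp: nn_integral_restrict_space measurable_restrict_space1)

lemma sets_circle_lebesgue [simp, measurable_cong]: "sets circle_lebesgue = sets borel"
  by (simp add: circle_lebesgue_def)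

lemma space_circle_lebesgue [simp]: "space circle_lebesgue = UNIV"
  by (simp add: circle_lebesgue_def)

lemma prob_space_circle_lebesgue: "prob_space circle_lebesgue"
  unfolding circle_lebesgue_def
  by (intro prob_space.prob_space_distr prob_spaceI measurable_restrict_space1)
     (auto simp: space_restrict_space emeasure_restrict_space)

lemma periodic_add_of_int:
  assumes "\<And>x. F (x + 1) = F (x::real)"
  shows "F (x + of_int m) = F x"
proof -
  have n: "F (x + real n) = F x" for x n
    by (induct n) (use assms in \<open>auto simp: add.assoc[symmetric] add.commute[of 1]\<close>)
  show ?thesis
  proof (cases "m \<ge> 0")
    case True
    then show ?thesis using n[of x "nat m"] by simp
  next
    case False
    then show ?thesis using n[of "x + of_int m" "nat (- m)"] by simp
  qed
qed

text \<open>With \<open>s = frac a\<close>, the window \<open>{s..<1 + s}\<close> is cut at 1, and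
  periodicity moves the overhang \<open>{1..<1 + s}\<close> back onto
  \<open>{0..<s}\<close>.\<close>

lemma nn_integral_periodic_shift:
  fixes G :: "real \<Rightarrow> ennreal"
  assumes [measurable]: "G \<in> borel_measurable borel" and per: "\<And>x. G (x + 1) = G x"
  shows "(\<integral>\<^sup>+x\<in>{0..<1}. G (x + a) \<partial>lborel) = (\<integral>\<^sup>+x\<in>{0..<1}. G x \<partial>lborel)"
proof -
  define s where "s = frac a"
  have s: "0 \<le> s" "s < 1" by (auto simp: s_def frac_lt_1)
  have "G (x + a) = G (x + s)" for x
    using periodic_add_of_int[of G "x + s" "\<lfloor>a\<rfloor>", OF per] by (simp add: s_def frac_def)
  then have "(\<integral>\<^sup>+x\<in>{0..<1}. G (x + a) \<partial>lborel) = (\<integral>\<^sup>+x. G (s + 1 * x) * indicator {s..<1 + s} (s + 1 * x) \<partial>lborel)"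
    by (auto intro!: nn_integral_cong simp: add.commute split: split_indicator)
  also have "\<dots> = (\<integral>\<^sup>+x. G x * indicator {s..<1 + s} x \<partial>lborel)"
    by (subst nn_integral_real_affine[where c=1 and t=s and f="\<lambda>x. G x * indicator {s..<1 + s} x"]) auto
  also have "\<dots> = (\<integral>\<^sup>+x. G x * indicator {s..<1} x + G x * indicator {1..<1 + s} x \<partial>lborel)"
    using s by (intro nn_integral_cong) (auto split: split_indicator)
  also have "\<dots> = (\<integral>\<^sup>+x. G x * indicator {s..<1} x \<partial>lborel) + (\<integral>\<^sup>+x. G x * indicator {1..<1 + s} x \<partial>lborel)"
    by (rule nn_integral_add) auto
  also have "(\<integral>\<^sup>+x. G x * indicator {1..<1 + s} x \<partial>lborel) = (\<integral>\<^sup>+x. G (1 + 1 * x) * indicator {1..<1 + s} (1 + 1 * x) \<partial>lborel)"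
    by (subst nn_integral_real_affine[where c=1 and t=1 and f="\<lambda>x. G x * indicator {1..<1 + s} x"]) auto
  also have "\<dots> = (\<integral>\<^sup>+x. G x * indicator {0..<s} x \<partial>lborel)"
    using per by (intro nn_integral_cong) (auto simp: add.commute split: split_indicator)
  also have "(\<integral>\<^sup>+x. G x * indicator {s..<1} x \<partial>lborel) + \<dots> = (\<integral>\<^sup>+x. G x * indicator {s..<1} x + G x * indicator {0..<s} x \<partial>lborel)"
    by (rule nn_integral_add[symmetric]) auto
  also have "\<dots> = (\<integral>\<^sup>+x\<in>{0..<1}. G x \<partial>lborel)"
    using s by (intro nn_integral_cong) (auto split: split_indicator)
  finally show ?thesis .
qed

text \<open>Rotations preserve both the distance and \<open>circle_lebesgue\<close>. They carry a
  shift of the noise density over to the test function, where Lipschitz continuity can act on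
  it.\<close>

lift_definition rotate :: "real \<Rightarrow> circle \<Rightarrow> circle" is "\<lambda>a x. x + a"
  by simp

lemma rotate_to_circle: "rotate a (to_circle y) = to_circle (y + a)"
  by (rule rotate.abs_eq)

lemma dist_rotate_same: "dist (rotate a x) (rotate a y) = dist x y"
proof (induct x rule: circle.abs_induct, induct y rule: circle.abs_induct)
  fix x y
  show "dist (rotate a (to_circle y)) (rotate a (to_circle x)) = dist (to_circle y) (to_circle x)"
    by (simp add: rotate_to_circle dist_circle.abs_eq)
qed

lemma dist_rotate_le: "dist (rotate a x) (rotate b x) \<le> \<bar>a - b\<bar>"
proof (induct x rule: circle.abs_induct)
  fix y
  show "dist (rotate a (to_circle y)) (rotate b (to_circle y)) \<le> \<bar>a - b\<bar>"
    using dist_to_circle_le[of "y + a" "y + b"] by (simp add: rotate_to_circle)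
qed

lemma measurable_rotate [measurable]: "rotate a \<in> borel_measurable borel"
  by (intro borel_measurable_continuous_onI lipschitz_on_continuous_on[of 1] lipschitz_onI)
     (auto simp: dist_rotate_same)

text \<open>The two arguments of \<open>F\<close> differ by an integer, the wrap-around of the
  representative in \<open>[0, 1)\<close>.\<close>

lemma periodic_circle_coord_rotate:
  assumes "\<And>x. F (x + 1) = F (x::real)"
  shows "F (circle_coord (rotate a x) - b) = F (circle_coord x + a - b)"
proof (induct x rule: circle.abs_induct)
  fix y
  have "F (frac (y + a) - b) = F (y + a - b)"
    using periodic_add_of_int[of F "frac (y + a) - b" "\<lfloor>y + a\<rfloor>", OF assms] by (simp add: frac_def algebra_simps)
  moreover have "F (frac y + a - b) = F (y + a - b)"
    using periodic_add_of_int[of F "frac y + a - b" "\<lfloor>y\<rfloor>", OF assms] by (simp add: frac_def algebra_simps)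
  ultimately show "F (circle_coord (rotate a (to_circle y)) - b) = F (circle_coord (to_circle y) + a - b)"
    by (simp add: rotate_to_circle circle_coord_to_circle)
qed

lemma nn_integral_circle_rotate:
  assumes [measurable]: "G \<in> borel_measurable borel"
  shows "(\<integral>\<^sup>+x. G (rotate a x) \<partial>circle_lebesgue) = (\<integral>\<^sup>+x. G x \<partial>circle_lebesgue)"
proof -
  have "to_circle (x + 1) = to_circle x" for x
    by (simp add: to_circle_eq_iff)
  then show ?thesis
    using nn_integral_periodic_shift[of "\<lambda>y. G (to_circle y)" a]
    by (simp add: nn_integral_circle_lebesgue rotate_to_circle)
qed

lemma distr_rotate_circle_lebesgue: "distr circle_lebesgue borel (rotate a) = circle_lebesgue"
proof (rule measure_eqI)
  fix A assume "A \<in> sets (distr circle_lebesgue borel (rotate a))"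
  then have [measurable]: "A \<in> sets borel" by simp
  have "emeasure (distr circle_lebesgue borel (rotate a)) A = (\<integral>\<^sup>+x. indicator A (rotate a x) \<partial>circle_lebesgue)"
    by (subst nn_integral_indicator[symmetric], simp, subst nn_integral_distr) auto
  also have "\<dots> = emeasure circle_lebesgue A"
    by (subst nn_integral_circle_rotate) auto
  finally show "emeasure (distr circle_lebesgue borel (rotate a)) A = emeasure circle_lebesgue A" .
qed simp

lemma integral_circle_rotate:
  fixes G :: "circle \<Rightarrow> real"
  assumes [measurable]: "G \<in> borel_measurable borel"
  shows "(\<integral>x. G (rotate a x) \<partial>circle_lebesgue) = (\<integral>x. G x \<partial>circle_lebesgue)"
  by (subst (2) distr_rotate_circle_lebesgue[of a, symmetric]) (simp add: integral_distr)

section \<open>Shifted noise\<close>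

text \<open>The law of \<open>a + \<omega>\<close> modulo 1 for \<omega> with density
  \<open>p\<close>: the conditional law of one new coordinate whose drift is
  \<open>a\<close>.\<close>

definition noise :: "(real \<Rightarrow> real) \<Rightarrow> real \<Rightarrow> circle measure"
  where "noise p a = density circle_lebesgue (\<lambda>x. ennreal (p (circle_coord x - a)))"

lemma sets_noise [simp, measurable_cong]: "sets (noise p a) = sets borel"
  by (simp add: noise_def)

lemma space_noise [simp]: "space (noise p a) = UNIV"
  by (simp add: noise_def)

context
  fixes p :: "real \<Rightarrow> real"
  assumes p: "periodic_density p"
begin

lemma measurable_p [measurable]: "p \<in> borel_measurable borel"
  and p_nonneg: "0 \<le> p x"
  and p_periodic: "p (x + 1) = p x"
  using p by (auto simp: periodic_density_def)

lemma p_frac: "p (frac x + a) = p (x + a)"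
  using periodic_add_of_int[of p "frac x + a" "\<lfloor>x\<rfloor>", OF p_periodic]
  by (simp add: frac_def algebra_simps)

lemma p_circle_coord: "p (circle_coord (to_circle y) - a) = p (y - a)"
  using p_frac[of y "- a"] by (simp add: circle_coord_to_circle)

lemma nn_integral_density_period: "(\<integral>\<^sup>+x\<in>{0..<1}. ennreal (p (x + a)) \<partial>lborel) = 1"
proof -
  have "(\<integral>\<^sup>+x\<in>{0..<1}. ennreal (p (x + a)) \<partial>lborel) = (\<integral>\<^sup>+x\<in>{0..<1}. ennreal (p x) \<partial>lborel)"
    by (rule nn_integral_periodic_shift) (auto simp: p_periodic)
  also have "\<dots> = (\<integral>\<^sup>+x\<in>{0..1}. ennreal (p x) \<partial>lborel)"
    by (intro nn_integral_cong_AE)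
       (auto intro!: eventually_mono[OF AE_lborel_singleton[of 1]] split: split_indicator)
  finally show ?thesis using p by (simp add: periodic_density_def)
qed

lemma nn_integral_noise_density: "(\<integral>\<^sup>+x. ennreal (p (circle_coord x - a)) \<partial>circle_lebesgue) = 1"
  using nn_integral_density_period[of "- a"]
  by (simp add: nn_integral_circle_lebesgue p_circle_coord)

lemma prob_space_noise: "prob_space (noise p a)"
  unfolding noise_def
  by (rule prob_spaceI) (simp add: emeasure_density nn_integral_noise_density)

lemma integrable_noise_density: "integrable circle_lebesgue (\<lambda>x. p (circle_coord x - a))"
  and integral_noise_density: "(\<integral>x. p (circle_coord x - a) \<partial>circle_lebesgue) = 1"
  using nn_integral_noise_density[of a]
  by (auto intro!: integrableI_nonneg integral_eq_nn_integral[THEN trans] p_nonneg)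

lemma integral_noise:
  fixes g :: "circle \<Rightarrow> real"
  assumes [measurable]: "g \<in> borel_measurable borel"
  shows "(\<integral>x. g x \<partial>noise p a) = (\<integral>x. p (circle_coord x - a) * g x \<partial>circle_lebesgue)"
  unfolding noise_def by (subst integral_density) (auto simp: p_nonneg)

lemma integrable_noise_density_mult:
  fixes g :: "circle \<Rightarrow> real"
  assumes [measurable]: "g \<in> borel_measurable borel" and "\<And>x. \<bar>g x\<bar> \<le> B"
  shows "integrable circle_lebesgue (\<lambda>x. p (circle_coord x - a) * g x)"
proof (rule Bochner_Integration.integrable_bound)
  show "integrable circle_lebesgue (\<lambda>x. B * p (circle_coord x - a))"
    by (intro integrable_mult_right integrable_noise_density)
  have "\<bar>p (circle_coord x - a) * g x\<bar> \<le> \<bar>B * p (circle_coord x - a)\<bar>" for x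
  proof -
    have "\<bar>p (circle_coord x - a) * g x\<bar> \<le> p (circle_coord x - a) * B"
      using assms(2)[of x] p_nonneg by (simp add: abs_mult mult_left_mono)
    then show ?thesis by (simp add: mult.commute)
  qed
  then show "AE x in circle_lebesgue. norm (p (circle_coord x - a) * g x) \<le> norm (B * p (circle_coord x - a))"
    by simp
qed simp

lemma integral_noise_rotate:
  fixes g :: "circle \<Rightarrow> real"
  assumes [measurable]: "g \<in> borel_measurable borel"
  shows "(\<integral>x. g x \<partial>noise p a) = (\<integral>x. p (circle_coord x) * g (rotate a x) \<partial>circle_lebesgue)"
proof -
  have "(\<integral>x. g x \<partial>noise p a) = (\<integral>x. p (circle_coord (rotate a x) - a) * g (rotate a x) \<partial>circle_lebesgue)"
    by (subst integral_circle_rotate) (auto simp: integral_noise)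
  then show ?thesis by (simp add: periodic_circle_coord_rotate[of p, OF p_periodic])
qed

text \<open>After the shift has been moved to \<open>g\<close>, the constant part \<open>c\<close>
  of the density integrates a rotated \<open>g\<close> against Lebesgue measure. Rotation invariance
  makes this independent of the shift, so it cancels in the difference. What remains is weighted by
  \<open>p - c \<ge> 0\<close>, and rotating by \<open>a\<close> instead of \<open>b\<close> moves
  each point by at most \<open>\<bar>a - b\<bar>\<close>.\<close>

lemma noise_Lipschitz:
  fixes g :: "circle \<Rightarrow> real"
  assumes [measurable]: "g \<in> borel_measurable borel" and B: "\<And>x. \<bar>g x\<bar> \<le> B"
    and L: "\<And>x y. \<bar>g x - g y\<bar> \<le> L * dist x y" "0 \<le> L"
    and c: "\<And>x. c \<le> p x"
  shows "\<bar>(\<integral>x. g x \<partial>noise p a) - (\<integral>x. g x \<partial>noise p b)\<bar> \<le> (1 - c) * L * \<bar>a - b\<bar>"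
proof -
  interpret prob_space circle_lebesgue by (rule prob_space_circle_lebesgue)
  let ?q = "\<lambda>x. p (circle_coord x)"
  have i: "integrable circle_lebesgue (\<lambda>x. ?q x * g (rotate a x))"
    "integrable circle_lebesgue (\<lambda>x. c * g (rotate a x))" for a
    using integrable_noise_density_mult[of "\<lambda>x. g (rotate a x)" B 0] B
    by (auto intro!: integrable_mult_right integrable_bounded)
  have iq: "integrable circle_lebesgue ?q" "(\<integral>x. ?q x \<partial>circle_lebesgue) = 1"
    using integrable_noise_density[of 0] integral_noise_density[of 0] by auto
  have *: "(\<integral>x. g x \<partial>noise p a) = (\<integral>x. (?q x - c) * g (rotate a x) \<partial>circle_lebesgue)
      + c * (\<integral>x. g x \<partial>circle_lebesgue)" for a
  proof -
    have "(\<integral>x. (?q x - c) * g (rotate a x) \<partial>circle_lebesgue)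
        = (\<integral>x. ?q x * g (rotate a x) - c * g (rotate a x) \<partial>circle_lebesgue)"
      by (simp add: algebra_simps)
    also have "\<dots> = (\<integral>x. ?q x * g (rotate a x) \<partial>circle_lebesgue) - c * (\<integral>x. g x \<partial>circle_lebesgue)"
      using i[of a] by (simp add: integral_circle_rotate)
    finally show ?thesis by (simp add: integral_noise_rotate)
  qed
  have i2: "integrable circle_lebesgue (\<lambda>x. (?q x - c) * g (rotate a x))" for a
    using i[of a] by (simp add: algebra_simps)
  have "\<bar>(\<integral>x. g x \<partial>noise p a) - (\<integral>x. g x \<partial>noise p b)\<bar>
      = \<bar>\<integral>x. (?q x - c) * (g (rotate a x) - g (rotate b x)) \<partial>circle_lebesgue\<bar>"
    using i2[of a] i2[of b] by (simp add: * right_diff_distrib)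
  also have "\<dots> \<le> (\<integral>x. \<bar>(?q x - c) * (g (rotate a x) - g (rotate b x))\<bar> \<partial>circle_lebesgue)"
    by (rule integral_abs_bound)
  also have "\<dots> \<le> (\<integral>x. (?q x - c) * (L * \<bar>a - b\<bar>) \<partial>circle_lebesgue)"
  proof (rule integral_mono)
    show "integrable circle_lebesgue (\<lambda>x. \<bar>(?q x - c) * (g (rotate a x) - g (rotate b x))\<bar>)"
      using i2[of a] i2[of b] by (auto simp: right_diff_distrib)
    show "integrable circle_lebesgue (\<lambda>x. (?q x - c) * (L * \<bar>a - b\<bar>))"
      using iq by auto
    fix x
    have "\<bar>g (rotate a x) - g (rotate b x)\<bar> \<le> L * \<bar>a - b\<bar>"
      by (rule order_trans[OF L(1) mult_left_mono[OF dist_rotate_le L(2)]])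
    then show "\<bar>(?q x - c) * (g (rotate a x) - g (rotate b x))\<bar> \<le> (?q x - c) * (L * \<bar>a - b\<bar>)"
      using c[of "circle_coord x"] by (auto simp: abs_mult intro!: mult_left_mono)
  qed
  also have "\<dots> = (1 - c) * L * \<bar>a - b\<bar>"
    using iq prob_space by simp
  finally show ?thesis .
qed

text \<open>The partition of \<open>[y, y + 1]\<close> is split at the point \<open>1\<close> by truncation; periodicity gives \<open>p 0 = p 1\<close>.\<close>

lemma shift_variation_le:
  assumes V: "\<And>(n::nat) (t::nat \<Rightarrow> real). mono_on {..n} t \<Longrightarrow> t ` {..n} \<subseteq> {0..1} \<Longrightarrow>
      (\<Sum>i<n. \<bar>p (t (Suc i)) - p (t i)\<bar>) \<le> V"
    and y: "0 \<le> y" "y \<le> 1" and d: "0 \<le> d" "real M * d \<le> 1"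
  shows "(\<Sum>i<M. \<bar>p (y + real (Suc i) * d) - p (y + real i * d)\<bar>) \<le> 2 * V"
proof -
  define t t1 t2 where "t = (\<lambda>i::nat. y + real i * d)"
    and "t1 = (\<lambda>i. min (t i) 1)" and "t2 = (\<lambda>i. max (t i) 1 - 1)"
  have t_mono: "t i \<le> t j" if "i \<le> j" for i j
    using that d by (auto simp: t_def intro!: mult_right_mono)
  have t_range: "0 \<le> t i" "i \<le> M \<Longrightarrow> t i \<le> 2" for i
  proof -
    show "0 \<le> t i" using y d by (simp add: t_def)
    assume "i \<le> M"
    then have "real i * d \<le> real M * d" using d by (intro mult_right_mono) auto
    then show "t i \<le> 2" using y d by (simp add: t_def)
  qed
  \<comment> \<open>If both points lie on the same side of 1, one of the two truncated increments
    carries the whole difference and the other vanishes. If they straddle 1, the difference passes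
    through \<open>p 1 = p 0\<close>.\<close>
  have "\<bar>p (t (Suc i)) - p (t i)\<bar> \<le> \<bar>p (t1 (Suc i)) - p (t1 i)\<bar> + \<bar>p (t2 (Suc i)) - p (t2 i)\<bar>" for i
  proof -
    have p1: "p (z - 1) = p z" for z using p_periodic[of "z - 1"] by simp
    have "p 0 = p 1" using p1[of 1] by simp
    then show ?thesis
      using t_mono[of i "Suc i"] by (auto simp: t1_def t2_def min_def max_def p1)
  qed
  then have "(\<Sum>i<M. \<bar>p (t (Suc i)) - p (t i)\<bar>)
      \<le> (\<Sum>i<M. \<bar>p (t1 (Suc i)) - p (t1 i)\<bar>) + (\<Sum>i<M. \<bar>p (t2 (Suc i)) - p (t2 i)\<bar>)"
    by (simp add: sum_mono flip: sum.distrib)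
  also have "\<dots> \<le> V + V"
  proof (intro add_mono V)
    show "mono_on {..M} t1" "mono_on {..M} t2"
      by (auto simp: t1_def t2_def min_def max_def intro!: mono_onI dest!: t_mono)
    show "t1 ` {..M} \<subseteq> {0..1}" "t2 ` {..M} \<subseteq> {0..1}"
      using t_range by (auto simp: t1_def t2_def)
  qed
  finally show ?thesis by (simp add: t_def)
qed

text \<open>By periodicity the integral is the same for all translates of the shift by multiples of \<open>d\<close>; about
  \<open>1 / d\<close> of them fit into one period, where their sum is bounded by the variation.\<close>

lemma shift_L1_le:
  assumes V: "\<And>(n::nat) (t::nat \<Rightarrow> real). mono_on {..n} t \<Longrightarrow> t ` {..n} \<subseteq> {0..1} \<Longrightarrow>
      (\<Sum>i<n. \<bar>p (t (Suc i)) - p (t i)\<bar>) \<le> V"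
    and d: "0 \<le> d"
  shows "(\<integral>\<^sup>+y\<in>{0..<1}. ennreal \<bar>p (y + d) - p y\<bar> \<partial>lborel) \<le> ennreal ((4 * V + 2) * d)"
proof -
  define J where "J = (\<integral>\<^sup>+y\<in>{0..<1}. ennreal \<bar>p (y + d) - p y\<bar> \<partial>lborel)"
  have V0: "0 \<le> V" using V[of 0 "\<lambda>_. 0"] by (simp add: mono_on_def)
  \<comment> \<open>This crude bound by the two total masses makes \<open>J\<close> finite and also
    settles shifts \<open>d > 1\<close>, where \<open>2 \<le> 2 * d\<close>. It is the source of the
    summand 2 in the constant.\<close>
  have "J \<le> (\<integral>\<^sup>+y. ennreal (p (y + d)) * indicator {0..<1} y + ennreal (p y) * indicator {0..<1} y \<partial>lborel)"
    unfolding J_def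
  proof (rule nn_integral_mono)
    fix y
    have "\<bar>p (y + d) - p y\<bar> \<le> p (y + d) + p y"
      using p_nonneg[of y] p_nonneg[of "y + d"] by linarith
    then show "ennreal \<bar>p (y + d) - p y\<bar> * indicator {0..<1} y
        \<le> ennreal (p (y + d)) * indicator {0..<1} y + ennreal (p y) * indicator {0..<1} y"
      by (auto simp: p_nonneg simp flip: ennreal_plus split: split_indicator)
  qed
  also have "\<dots> = 1 + 1"
    using nn_integral_density_period[of d] nn_integral_density_period[of 0]
    by (subst nn_integral_add) auto
  finally have J2: "J \<le> 2" by simp
  then obtain j where j: "J = ennreal j" "0 \<le> j"
    by (cases J) (auto simp: top_unique)
  have "j \<le> (4 * V + 2) * d"
  proof (cases "0 < d \<and> d \<le> 1")
    case True
    define M where "M = nat \<lfloor>1 / d\<rfloor>"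
    have "\<lfloor>1 / d\<rfloor> \<ge> 1" using True by simp
    then have "1 \<le> M" "real M = of_int \<lfloor>1 / d\<rfloor>"
      unfolding M_def by linarith+
    then have M: "1 \<le> M" "real M \<le> 1 / d" "1 / d < real M + 1"
      by linarith+
    then have Md: "real M * d \<le> 1" "1 < (real M + 1) * d"
      using True by (auto simp: field_simps)
    have "of_nat M * J = (\<Sum>i<M. J)" by simp
    also have "\<dots> = (\<Sum>i<M. \<integral>\<^sup>+y\<in>{0..<1}. ennreal \<bar>p (y + real (Suc i) * d) - p (y + real i * d)\<bar> \<partial>lborel)"
    proof (rule sum.cong[OF refl])
      fix i
      have "J = (\<integral>\<^sup>+y\<in>{0..<1}. ennreal \<bar>p ((y + real i * d) + d) - p (y + real i * d)\<bar> \<partial>lborel)"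
        unfolding J_def
        using p_periodic p_periodic[of "_ + d"]
        by (intro nn_integral_periodic_shift[symmetric]) (auto simp: ac_simps)
      then show "J = (\<integral>\<^sup>+y\<in>{0..<1}. ennreal \<bar>p (y + real (Suc i) * d) - p (y + real i * d)\<bar> \<partial>lborel)"
        by (simp add: algebra_simps)
    qed
    also have "\<dots> = (\<integral>\<^sup>+y. (\<Sum>i<M. ennreal \<bar>p (y + real (Suc i) * d) - p (y + real i * d)\<bar> * indicator {0..<1} y) \<partial>lborel)"
      by (subst nn_integral_sum) auto
    also have "\<dots> \<le> (\<integral>\<^sup>+y\<in>{0..<1::real}. ennreal (2 * V) \<partial>lborel)"
    proof (rule nn_integral_mono)
      fix y :: real
      have "ennreal (\<Sum>i<M. \<bar>p (y + real (Suc i) * d) - p (y + real i * d)\<bar>) \<le> ennreal (2 * V)"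
        if "0 \<le> y" "y < 1"
        using that True Md by (intro ennreal_leI shift_variation_le V) auto
      then show "(\<Sum>i<M. ennreal \<bar>p (y + real (Suc i) * d) - p (y + real i * d)\<bar> * indicator {0..<1} y)
          \<le> ennreal (2 * V) * indicator {0..<1} y"
        by (cases "y \<in> {0..<1}") (simp_all del: of_nat_Suc)
    qed
    also have "\<dots> = ennreal (2 * V)" by (simp add: nn_integral_cmult_indicator)
    finally have "real M * j \<le> 2 * V"
      using j V0 by (simp add: ennreal_of_nat_eq_real_of_nat flip: ennreal_mult)
    then have "real M * j * d \<le> 2 * V * d" using True by (intro mult_right_mono) auto
    \<comment> \<open>Since \<open>d \<le> M * d\<close> and \<open>(M + 1) * d > 1\<close>, the
      translates cover at least half a period. Rounding \<open>1 / d\<close> down thus costs a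
      factor 2, which turns \<open>2 * V\<close> into \<open>4 * V\<close>.\<close>
    moreover have "1 * d \<le> real M * d"
      using M True by (intro mult_right_mono) auto
    then have "1 \<le> 2 * (real M * d)"
      using Md(2) by (simp add: algebra_simps)
    then have "1 * j \<le> 2 * (real M * d) * j" using j(2) by (rule mult_right_mono)
    ultimately have "j \<le> 2 * (2 * V * d)" by (simp add: algebra_simps)
    then show ?thesis using True by (simp add: algebra_simps)
  next
    case False
    show ?thesis
    proof (cases "d = 0")
      case True
      then have "J = 0" by (simp add: J_def)
      then show ?thesis using True j by simp
    next
      case F: False
      have "j \<le> 2" using J2 unfolding j by (simp flip: ennreal_numeral)
      moreover have "0 \<le> V * d" "2 * 1 \<le> 2 * d" using V0 d False F by auto
      ultimately show ?thesis by (simp add: algebra_simps)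
    qed
  qed
  then show ?thesis using j V0 d unfolding J_def[symmetric] by (simp add: ennreal_leI)
qed

text \<open>Rotating a merely bounded \<open>g\<close> gives no small difference, so here the shift
  stays on the density, and the L1 distance of two translates of \<open>p\<close> is estimated by
  \<open>shift_L1_le\<close>.\<close>

lemma noise_bounded_variation:
  fixes g :: "circle \<Rightarrow> real"
  assumes V: "\<And>(n::nat) (t::nat \<Rightarrow> real). mono_on {..n} t \<Longrightarrow> t ` {..n} \<subseteq> {0..1} \<Longrightarrow>
      (\<Sum>i<n. \<bar>p (t (Suc i)) - p (t i)\<bar>) \<le> V"
    and [measurable]: "g \<in> borel_measurable borel" and B: "\<And>x. \<bar>g x\<bar> \<le> 1"
  shows "\<bar>(\<integral>x. g x \<partial>noise p a) - (\<integral>x. g x \<partial>noise p b)\<bar> \<le> (4 * V + 2) * \<bar>a - b\<bar>"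
proof (induct a b rule: linorder_wlog)
  case (sym a b)
  then show ?case by (simp add: abs_minus_commute)
next
  case (le a b)
  have V0: "0 \<le> V" using V[of 0 "\<lambda>_. 0"] by (simp add: mono_on_def)
  let ?q = "\<lambda>a x. p (circle_coord x - a)"
  have i: "integrable circle_lebesgue (\<lambda>x. ?q a x * g x)" for a
    using B by (intro integrable_noise_density_mult[where B=1]) auto
  have "\<bar>(\<integral>x. g x \<partial>noise p a) - (\<integral>x. g x \<partial>noise p b)\<bar>
      = \<bar>\<integral>x. ?q a x * g x - ?q b x * g x \<partial>circle_lebesgue\<bar>"
    using i[of a] i[of b] by (simp add: integral_noise)
  also have "\<dots> \<le> (\<integral>x. \<bar>?q a x * g x - ?q b x * g x\<bar> \<partial>circle_lebesgue)"
    by (rule integral_abs_bound)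
  also have "\<dots> \<le> (\<integral>x. \<bar>?q a x - ?q b x\<bar> \<partial>circle_lebesgue)"
  proof (rule integral_mono)
    fix x
    have "\<bar>?q a x - ?q b x\<bar> * \<bar>g x\<bar> \<le> \<bar>?q a x - ?q b x\<bar> * 1"
      using B by (intro mult_left_mono) auto
    then show "\<bar>?q a x * g x - ?q b x * g x\<bar> \<le> \<bar>?q a x - ?q b x\<bar>"
      by (simp add: abs_mult flip: left_diff_distrib)
  qed (use i[of a] i[of b] integrable_noise_density in auto)
  also have "\<dots> = enn2real (\<integral>\<^sup>+x. ennreal \<bar>?q a x - ?q b x\<bar> \<partial>circle_lebesgue)"
    by (rule integral_eq_nn_integral) auto
  also have "\<dots> \<le> (4 * V + 2) * \<bar>a - b\<bar>"
  proof -
    have "(\<integral>\<^sup>+x. ennreal \<bar>?q a x - ?q b x\<bar> \<partial>circle_lebesgue)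
        = (\<integral>\<^sup>+y\<in>{0..<1}. ennreal \<bar>p ((y - b) + (b - a)) - p (y - b)\<bar> \<partial>lborel)"
      by (simp add: nn_integral_circle_lebesgue p_circle_coord)
    also have "\<dots> = (\<integral>\<^sup>+y\<in>{0..<1}. ennreal \<bar>p (y + (b - a)) - p y\<bar> \<partial>lborel)"
      using nn_integral_periodic_shift[of "\<lambda>y. ennreal \<bar>p (y + (b - a)) - p y\<bar>" "- b"]
        p_periodic p_periodic[of "_ + (b - a)"] by (simp add: ac_simps)
    also have "\<dots> \<le> ennreal ((4 * V + 2) * (b - a))"
      using le by (intro shift_L1_le V) auto
    finally show ?thesis
      using le V0 by (intro enn2real_leI) (auto simp: abs_if)
  qed
  finally show ?case .
qed

end

section \<open>Product measures\<close>

text \<open>The two product measures agree off \<open>j\<close>, so integrating coordinate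
  \<open>j\<close> innermost leaves the same outer measure on both sides, and the pointwise bound
  \<open>e\<close> is averaged. \<open>S\<close> fixes the common sigma-algebras, so that
  measurability of \<open>g\<close> can be stated independently of the factors.\<close>

lemma PiM_integral_diff_le_single:
  fixes M M' S :: "'i \<Rightarrow> 'a measure" and g :: "('i \<Rightarrow> 'a) \<Rightarrow> real"
  assumes I: "finite I" "j \<in> I"
    and prob: "\<And>i. prob_space (M i)" "\<And>i. prob_space (M' i)"
    and sets: "\<And>i. sets (M i) = sets (S i)" "\<And>i. sets (M' i) = sets (S i)"
    and g: "g \<in> borel_measurable (PiM I S)" "\<And>x. x \<in> space (PiM I S) \<Longrightarrow> \<bar>g x\<bar> \<le> B"
    and eq: "\<And>i. i \<in> I \<Longrightarrow> i \<noteq> j \<Longrightarrow> M i = M' i"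
    and e: "\<And>x. x \<in> space (PiM I S) \<Longrightarrow>
      \<bar>(\<integral>y. g (x(j := y)) \<partial>M j) - (\<integral>y. g (x(j := y)) \<partial>M' j)\<bar> \<le> e"
  shows "\<bar>(\<integral>x. g x \<partial>PiM I M) - (\<integral>x. g x \<partial>PiM I M')\<bar> \<le> e"
proof -
  define J where "J = I - {j}"
  have J: "finite J" "j \<notin> J" "I = insert j J" using I by (auto simp: J_def)
  interpret M: product_prob_space M J
    using prob by (intro product_prob_spaceI)
  interpret M': product_prob_space M' J
    using prob by (intro product_prob_spaceI)
  note sets [measurable_cong]
  have spI: "sets (PiM I M) = sets (PiM I S)" "sets (PiM I M') = sets (PiM I S)"
    using sets by (auto intro!: sets_PiM_cong)
  note spI' = spI[THEN sets_eq_imp_space_eq]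
  have pI: "prob_space (PiM I M)" "prob_space (PiM I M')"
    using prob by (auto intro!: prob_space_PiM)
  have int: "integrable (PiM I M) g" "integrable (PiM I M') g"
    using g spI' by (auto intro!: prob_space.integrable_bounded[OF pI(1)] prob_space.integrable_bounded[OF pI(2)]
        simp: measurable_cong_sets[OF spI(1) refl] measurable_cong_sets[OF spI(2) refl])
  have PJ: "PiM J M' = PiM J M"
    using eq[symmetric] J by (intro PiM_cong) auto
  have gJ: "(\<lambda>(x, y). g (x(j := y))) \<in> borel_measurable (PiM J M \<Otimes>\<^sub>M M j)"
    "(\<lambda>(x, y). g (x(j := y))) \<in> borel_measurable (PiM J M \<Otimes>\<^sub>M M' j)"
  proof -
    have [measurable]: "g \<in> borel_measurable (PiM (insert j J) S)" using g(1) J(3) by simp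
    show "(\<lambda>(x, y). g (x(j := y))) \<in> borel_measurable (PiM J M \<Otimes>\<^sub>M M j)"
      "(\<lambda>(x, y). g (x(j := y))) \<in> borel_measurable (PiM J M \<Otimes>\<^sub>M M' j)"
      by measurable
  qed
  have upd: "x(j := y) \<in> space (PiM I S)" if "x \<in> space (PiM J M)" "y \<in> space (S j)" for x y
    using that sets[THEN sets_eq_imp_space_eq] J(3)
    by (auto simp: space_PiM PiE_iff extensional_def)
  have inner: "(\<lambda>x. \<integral>y. g (x(j := y)) \<partial>N) \<in> borel_measurable (PiM J M)"
      "\<And>x. x \<in> space (PiM J M) \<Longrightarrow> \<bar>\<integral>y. g (x(j := y)) \<partial>N\<bar> \<le> B"
    if N: "prob_space N" "sets N = sets (S j)"
      "(\<lambda>(x, y). g (x(j := y))) \<in> borel_measurable (PiM J M \<Otimes>\<^sub>M N)" for N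
  proof -
    interpret N: prob_space N by fact
    show "(\<lambda>x. \<integral>y. g (x(j := y)) \<partial>N) \<in> borel_measurable (PiM J M)"
      by (rule N.borel_measurable_lebesgue_integral[OF N(3)])
    fix x assume x: "x \<in> space (PiM J M)"
    show "\<bar>\<integral>y. g (x(j := y)) \<partial>N\<bar> \<le> B"
    proof (rule N.abs_integral_le_bound)
      show "(\<lambda>y. g (x(j := y))) \<in> borel_measurable N"
        using measurable_compose[OF measurable_Pair1'[OF x] N(3)] by simp
      show "\<bar>g (x(j := y))\<bar> \<le> B" if "y \<in> space N" for y
        using that x N(2)[THEN sets_eq_imp_space_eq] by (intro g upd) auto
    qed
  qed
  have i: "integrable (PiM J M) (\<lambda>x. \<integral>y. g (x(j := y)) \<partial>M j)"
    "integrable (PiM J M) (\<lambda>x. \<integral>y. g (x(j := y)) \<partial>M' j)"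
    using inner[OF prob(1) sets(1) gJ(1)] inner[OF prob(2) sets(2) gJ(2)]
    by (auto intro!: M.integrable_bounded)
  have "(\<integral>x. g x \<partial>PiM I M) - (\<integral>x. g x \<partial>PiM I M')
      = (\<integral>x. (\<integral>y. g (x(j := y)) \<partial>M j) - (\<integral>y. g (x(j := y)) \<partial>M' j) \<partial>PiM J M)"
    using int i J by (simp add: M.product_integral_insert M'.product_integral_insert PJ)
  also have "\<bar>\<dots>\<bar> \<le> e"
  proof (rule M.abs_integral_le_bound)
    fix x assume x: "x \<in> space (PiM J M)"
    obtain y where "y \<in> space (S j)"
      using prob_space.not_empty[OF prob(1)[of j]] sets[THEN sets_eq_imp_space_eq] by auto
    then show "\<bar>(\<integral>y. g (x(j := y)) \<partial>M j) - (\<integral>y. g (x(j := y)) \<partial>M' j)\<bar> \<le> e"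
      using e[OF upd[OF x]] by fastforce
  qed (use i in auto)
  finally show ?thesis .
qed

text \<open>Hybrid argument: the factors are exchanged one at a time, \<open>H J\<close> being the
  product in which those in \<open>J\<close> have already been replaced, and the single-factor
  errors add up.\<close>

lemma PiM_integral_diff_le:
  fixes M M' S :: "'i \<Rightarrow> 'a measure" and g :: "('i \<Rightarrow> 'a) \<Rightarrow> real"
  assumes I: "finite I"
    and prob: "\<And>i. prob_space (M i)" "\<And>i. prob_space (M' i)"
    and sets: "\<And>i. sets (M i) = sets (S i)" "\<And>i. sets (M' i) = sets (S i)"
    and g: "g \<in> borel_measurable (PiM I S)" "\<And>x. x \<in> space (PiM I S) \<Longrightarrow> \<bar>g x\<bar> \<le> B"
    and e: "\<And>i x. i \<in> I \<Longrightarrow> x \<in> space (PiM I S) \<Longrightarrow>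
      \<bar>(\<integral>y. g (x(i := y)) \<partial>M i) - (\<integral>y. g (x(i := y)) \<partial>M' i)\<bar> \<le> e i"
  shows "\<bar>(\<integral>x. g x \<partial>PiM I M) - (\<integral>x. g x \<partial>PiM I M')\<bar> \<le> (\<Sum>i\<in>I. e i)"
proof -
  define H where "H = (\<lambda>J i. if i \<in> J then M' i else M i)"
  have "\<bar>(\<integral>x. g x \<partial>PiM I M) - (\<integral>x. g x \<partial>PiM I (H J))\<bar> \<le> (\<Sum>i\<in>J. e i)"
    if "finite J" "J \<subseteq> I" for J
    using that
  proof (induct J)
    case empty
    then show ?case by (simp add: H_def)
  next
    case (insert j J)
    have "\<bar>(\<integral>x. g x \<partial>PiM I (H J)) - (\<integral>x. g x \<partial>PiM I (H (insert j J)))\<bar> \<le> e j"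
      by (rule PiM_integral_diff_le_single[where S=S and j=j and B=B])
         (use insert in \<open>auto simp: H_def sets I prob g e\<close>)
    with insert show ?case by simp
  qed
  from this[OF I] have "\<bar>(\<integral>x. g x \<partial>PiM I M) - (\<integral>x. g x \<partial>PiM I (H I))\<bar> \<le> (\<Sum>i\<in>I. e i)"
    by simp
  moreover have "PiM I (H I) = PiM I M'"
    by (rule PiM_cong) (auto simp: H_def)
  ultimately show ?thesis by simp
qed

text \<open>On boxes both indicator and density factorise over the coordinates, so the integral is a
  product of one-dimensional ones; boxes determine the product measure.\<close>

lemma density_PiM:
  assumes I: "finite I" and M: "\<And>i. sigma_finite_measure (M i)"
    and f: "\<And>i. i \<in> I \<Longrightarrow> f i \<in> borel_measurable (M i)"
    and D: "\<And>i. sigma_finite_measure (density (M i) (f i))"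
  shows "density (PiM I M) (\<lambda>x. \<Prod>i\<in>I. f i (x i)) = PiM I (\<lambda>i. density (M i) (f i))"
proof -
  interpret M: product_sigma_finite M using M by (rule product_sigma_finite.intro)
  interpret D: product_sigma_finite "\<lambda>i. density (M i) (f i)" using D by (rule product_sigma_finite.intro)
  have fm [measurable]: "(\<lambda>x. \<Prod>i\<in>I. f i (x i)) \<in> borel_measurable (PiM I M)"
    using f by (intro borel_measurable_prod_ennreal) (auto intro!: measurable_compose[OF measurable_component_singleton])
  show ?thesis
  proof (rule D.PiM_eqI[OF I])
    show "sets (density (PiM I M) (\<lambda>x. \<Prod>i\<in>I. f i (x i))) = sets (PiM I (\<lambda>i. density (M i) (f i)))"
      by (simp cong: sets_PiM_cong)
    fix A assume "\<And>i. i \<in> I \<Longrightarrow> A i \<in> sets (density (M i) (f i))"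
    then have A: "\<And>i. i \<in> I \<Longrightarrow> A i \<in> sets (M i)" by simp
    have "emeasure (density (PiM I M) (\<lambda>x. \<Prod>i\<in>I. f i (x i))) (Pi\<^sub>E I A)
        = (\<integral>\<^sup>+x. (\<Prod>i\<in>I. f i (x i)) * indicator (Pi\<^sub>E I A) x \<partial>PiM I M)"
      using I A by (subst emeasure_density) auto
    also have "\<dots> = (\<integral>\<^sup>+x. (\<Prod>i\<in>I. f i (x i) * indicator (A i) (x i)) \<partial>PiM I M)"
    proof (rule nn_integral_cong)
      fix x assume "x \<in> space (PiM I M)"
      then have "indicator (Pi\<^sub>E I A) x = (\<Prod>i\<in>I. indicator (A i) (x i) :: ennreal)"
        using I by (auto simp: indicator_def space_PiM PiE_iff prod_zero_iff)
      then show "(\<Prod>i\<in>I. f i (x i)) * indicator (Pi\<^sub>E I A) x = (\<Prod>i\<in>I. f i (x i) * indicator (A i) (x i))"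
        by (simp add: prod.distrib)
    qed
    also have "\<dots> = (\<Prod>i\<in>I. \<integral>\<^sup>+y. f i y * indicator (A i) y \<partial>M i)"
      using I A f by (intro M.product_nn_integral_prod) auto
    also have "\<dots> = (\<Prod>i\<in>I. emeasure (density (M i) (f i)) (A i))"
      using A f by (intro prod.cong) (auto simp: emeasure_density)
    finally show "emeasure (density (PiM I M) (\<lambda>x. \<Prod>i\<in>I. f i (x i))) (Pi\<^sub>E I A)
        = (\<Prod>i\<in>I. emeasure (density (M i) (f i)) (A i))" .
  qed
qed

section \<open>Lipschitz test functions and the Dobrushin-Wasserstein distance\<close>

text \<open>A certificate for \<open>LipN\<close> with explicit real constants per coordinate. It
  replaces suprema in \<open>ennreal\<close> by inequalities that can be scaled and summed in real
  arithmetic.\<close>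

definition coord_lipschitz :: "nat \<Rightarrow> (nat \<Rightarrow> real) \<Rightarrow> ((nat \<Rightarrow> circle) \<Rightarrow> real) \<Rightarrow> bool"
  where "coord_lipschitz N L g \<longleftrightarrow> (\<forall>i\<in>{1..N}. 0 \<le> L i) \<and>
    (\<forall>x\<in>{1..N} \<rightarrow>\<^sub>E UNIV. \<forall>i\<in>{1..N}. \<forall>y. \<bar>g x - g (x(i := y))\<bar> \<le> L i * dist (x i) y)"

lemma space_torus: "space (PiM I (\<lambda>_. borel)) = I \<rightarrow>\<^sub>E UNIV"
  by (simp add: space_PiM)

text \<open>The path from \<open>x\<close> to \<open>y\<close> changes one coordinate at a time;
  each intermediate point \<open>H J\<close> remains extensional, so the coordinatewise bound
  applies to it.\<close>

lemma coord_lipschitz_le_sum: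
  assumes L: "coord_lipschitz N L g" and x: "x \<in> space (torus N)" and y: "y \<in> space (torus N)"
  shows "\<bar>g x - g y\<bar> \<le> (\<Sum>i=1..N. L i * dist (x i) (y i))"
proof -
  define H where "H = (\<lambda>J i. if i \<in> J then y i else x i)"
  have "\<bar>g x - g (H J)\<bar> \<le> (\<Sum>i\<in>J. L i * dist (x i) (y i))" if "finite J" "J \<subseteq> {1..N}" for J
    using that
  proof (induct J)
    case empty
    then show ?case by (simp add: H_def)
  next
    case (insert j J)
    have *: "H (insert j J) = (H J)(j := y j)" by (auto simp: H_def)
    have "H J \<in> {1..N} \<rightarrow>\<^sub>E UNIV"
      using x y insert(4) by (auto simp: H_def space_torus PiE_iff extensional_def)
    then have "\<bar>g (H J) - g (H (insert j J))\<bar> \<le> L j * dist (H J j) (y j)"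
      using L insert(4) unfolding * coord_lipschitz_def by auto
    moreover have "H J j = x j" using insert by (simp add: H_def)
    ultimately have "\<bar>g (H J) - g (H (insert j J))\<bar> \<le> L j * dist (x j) (y j)" by simp
    with insert show ?case by simp
  qed
  from this[of "{1..N}"] have "\<bar>g x - g (H {1..N})\<bar> \<le> (\<Sum>i=1..N. L i * dist (x i) (y i))"
    by simp
  moreover have "H {1..N} = y"
    using x y by (auto simp: H_def space_torus PiE_iff extensional_def)
  ultimately show ?thesis by simp
qed

lemma coord_lipschitz_oscillation:
  assumes "coord_lipschitz N L g" "x \<in> space (torus N)" "y \<in> space (torus N)"
  shows "\<bar>g x - g y\<bar> \<le> (\<Sum>i=1..N. L i) / 2"
proof -
  have "(\<Sum>i=1..N. L i * dist (x i) (y i)) \<le> (\<Sum>i=1..N. L i * (1 / 2))"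
    using assms(1) by (intro sum_mono mult_left_mono dist_circle_le_half) (auto simp: coord_lipschitz_def)
  then show ?thesis
    using coord_lipschitz_le_sum[OF assms] by (simp add: sum_divide_distrib)
qed

text \<open>The test functions of \<open>W1\<close> carry no measurability requirement, so it must
  be derived. Precomposing with the restriction to \<open>{1..N}\<close> extends \<open>g\<close> to
  a function \<open>g'\<close> on all of \<open>nat \<Rightarrow> circle\<close> that is continuous
  in the product topology. Pulling \<open>g'\<close> back along the inclusion recovers
  \<open>g\<close>; the inclusion is measurable because on the torus the coordinates outside
  \<open>{1..N}\<close> are constantly \<open>undefined\<close>.\<close>

lemma measurable_coord_lipschitz:
  assumes L: "coord_lipschitz N L g"
  shows "g \<in> borel_measurable (torus N)"
proof -
  define g' where "g' = (\<lambda>x. g (restrict x {1..N}))"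
  have "continuous_on UNIV g'"
  proof (clarsimp simp: continuous_on_eq_continuous_at isCont_def)
    fix x :: "nat \<Rightarrow> circle"
    have c: "((\<lambda>y::nat \<Rightarrow> circle. y i) \<longlongrightarrow> x i) (at x)" for i
      using continuous_on_product_coordinates[of i] unfolding continuous_on_def by blast
    have "((\<lambda>y. \<Sum>i=1..N. L i * dist (y i) (x i)) \<longlongrightarrow> (\<Sum>i=1..N. L i * dist (x i) (x i))) (at x)"
      by (intro tendsto_intros c)
    then have lim: "((\<lambda>y. \<Sum>i=1..N. L i * dist (y i) (x i)) \<longlongrightarrow> 0) (at x)" by simp
    have bound: "dist (g' y) (g' x) \<le> (\<Sum>i=1..N. L i * dist (y i) (x i))" for y
      using coord_lipschitz_le_sum[OF L, of "restrict y {1..N}" "restrict x {1..N}"]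
      by (simp add: g'_def dist_real_def space_torus)
    show "(g' \<longlongrightarrow> g' x) (at x)"
      unfolding tendsto_dist_iff[of g']
      by (rule tendsto_sandwich[OF _ _ tendsto_const lim]) (use bound in auto)
  qed
  then have "g' \<in> borel_measurable (PiM UNIV (\<lambda>_. borel))"
    by (simp add: borel_measurable_continuous_onI cong: measurable_cong_sets[OF sets_PiM_equal_borel])
  moreover have "(\<lambda>x. x) \<in> measurable (torus N) (PiM UNIV (\<lambda>_. borel))"
  proof (rule measurable_PiM_single')
    fix i
    show "(\<lambda>x. x i) \<in> borel_measurable (torus N)"
    proof (cases "i \<in> {1..N}")
      case False
      then have "(\<lambda>x. x i) \<in> borel_measurable (torus N) \<longleftrightarrow> (\<lambda>x. undefined::circle) \<in> borel_measurable (torus N)"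
        by (intro measurable_cong) (auto simp: space_torus PiE_iff extensional_def)
      then show ?thesis by simp
    qed (rule measurable_component_singleton)
  qed auto
  ultimately have "(\<lambda>x. g' x) \<in> borel_measurable (torus N)"
    by (rule measurable_compose[rotated])
  moreover have "g' x = g x" if "x \<in> space (torus N)" for x
    using that by (simp add: g'_def space_torus PiE_iff extensional_restrict)
  ultimately show ?thesis using measurable_cong[of "torus N" g' g borel] by blast
qed

text \<open>A sum of at most 1 forces every summand to be finite, so passing to reals by
  \<open>enn2real\<close> loses nothing.\<close>

lemma coord_lipschitz_of_LipN:
  assumes "LipN N g \<le> 1"
  obtains L where "coord_lipschitz N L g" "(\<Sum>i=1..N. L i) \<le> 1"
proof
  define L where "L = (\<lambda>i. enn2real (Lip_coord N i g))"
  have le1: "Lip_coord N i g \<le> 1" if "i \<in> {1..N}" for i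
    using assms member_le_sum[of i "{1..N}" "\<lambda>i. Lip_coord N i g"] that
    unfolding LipN_def by auto
  have L: "Lip_coord N i g = ennreal (L i)" if "i \<in> {1..N}" for i
    unfolding L_def by (rule ennreal_enn2real[symmetric], rule le_less_trans[OF le1[OF that]]) simp
  have "LipN N g = (\<Sum>i=1..N. ennreal (L i))"
    unfolding LipN_def by (intro sum.cong L refl)
  also have "\<dots> = ennreal (\<Sum>i=1..N. L i)"
    by (rule sum_ennreal) (simp add: L_def)
  finally have "ennreal (\<Sum>i=1..N. L i) \<le> ennreal 1"
    using assms by simp
  then show "(\<Sum>i=1..N. L i) \<le> 1"
    by (simp only: ennreal_le_iff zero_le_one)
  show "coord_lipschitz N L g"
    unfolding coord_lipschitz_def
  proof (intro conjI ballI allI)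
    show "0 \<le> L i" for i by (simp add: L_def)
    fix x i y assume x: "x \<in> {1..N} \<rightarrow>\<^sub>E (UNIV :: circle set)" and i: "i \<in> {1..N}"
    show "\<bar>g x - g (x(i := y))\<bar> \<le> L i * dist (x i) y"
    proof (cases "x i = y")
      case True
      then have "x(i := y) = x" by auto
      then show ?thesis by (simp add: L_def)
    next
      case False
      have "ennreal (\<bar>g x - g (x(i := y))\<bar> / dist (x i) y) \<le> Lip_coord N i g"
        unfolding Lip_coord_def by (rule SUP_upper2[of "(x, y)"]) (use x False in auto)
      then have "\<bar>g x - g (x(i := y))\<bar> / dist (x i) y \<le> L i"
        unfolding L[OF i] by (simp add: L_def)
      then show ?thesis using False by (simp add: field_simps)
    qed
  qed
qed

lemma LipN_le_of_coord_lipschitz: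
  assumes L: "coord_lipschitz N L g"
  shows "LipN N g \<le> ennreal (\<Sum>i=1..N. L i)"
proof -
  have "Lip_coord N i g \<le> ennreal (L i)" if i: "i \<in> {1..N}" for i
    unfolding Lip_coord_def
  proof (rule SUP_least, clarify)
    fix x y assume "x \<in> {1..N} \<rightarrow>\<^sub>E (UNIV :: circle set)" "x i \<noteq> y"
    moreover from this have "\<bar>g x - g (x(i := y))\<bar> \<le> L i * dist (x i) y"
      using L i by (simp add: coord_lipschitz_def)
    ultimately show "ennreal (\<bar>g x - g (x(i := y))\<bar> / dist (x i) y) \<le> ennreal (L i)"
      by (intro ennreal_leI) (simp add: field_simps)
  qed
  then have "LipN N g \<le> (\<Sum>i=1..N. ennreal (L i))"
    unfolding LipN_def by (intro sum_mono) auto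
  also have "\<dots> = ennreal (\<Sum>i=1..N. L i)"
    using L by (intro sum_ennreal) (auto simp: coord_lipschitz_def)
  finally show ?thesis .
qed

lemma coord_lipschitz_bounded:
  assumes "coord_lipschitz N L g"
  obtains B where "\<And>x. x \<in> space (torus N) \<Longrightarrow> \<bar>g x\<bar> \<le> B"
proof
  define x0 :: "nat \<Rightarrow> circle" where "x0 = restrict (\<lambda>_. undefined) {1..N}"
  have x0: "x0 \<in> space (torus N)" by (simp add: x0_def space_torus)
  fix x assume "x \<in> space (torus N)"
  from coord_lipschitz_oscillation[OF assms this x0]
  show "\<bar>g x\<bar> \<le> (\<Sum>i=1..N. L i) / 2 + \<bar>g (restrict (\<lambda>_. undefined) {1..N})\<bar>"
    unfolding x0_def by linarith
qed

text \<open>Each integral lies within half the sum of the constants from the value at a fixed point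
  \<open>x0\<close>, because the circle has diameter at most 1/2. This yields the boundedness that
  the real-valued supremum in \<open>W1\<close> requires.\<close>

lemma coord_lipschitz_integral_diff_le:
  assumes L: "coord_lipschitz N L g"
    and \<mu>: "\<mu>1 \<in> space (prob_algebra (torus N))" "\<mu>2 \<in> space (prob_algebra (torus N))"
  shows "(\<integral>x. g x \<partial>\<mu>1) - (\<integral>x. g x \<partial>\<mu>2) \<le> (\<Sum>i=1..N. L i)"
proof -
  define x0 :: "nat \<Rightarrow> circle" where "x0 = restrict (\<lambda>_. undefined) {1..N}"
  have x0: "x0 \<in> space (torus N)" by (simp add: x0_def space_torus)
  have *: "\<bar>(\<integral>x. g x \<partial>\<mu>) - g x0\<bar> \<le> (\<Sum>i=1..N. L i) / 2"
    if "\<mu> \<in> space (prob_algebra (torus N))" for \<mu>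
  proof -
    have s: "sets \<mu> = sets (torus N)" "prob_space \<mu>"
      using that by (auto simp: space_prob_algebra)
    interpret prob_space \<mu> by fact
    have sp: "space \<mu> = space (torus N)" using s(1) by (rule sets_eq_imp_space_eq)
    have m: "g \<in> borel_measurable \<mu>"
      using measurable_coord_lipschitz[OF L] by (simp add: measurable_cong_sets[OF s(1) refl])
    obtain B where B: "\<And>x. x \<in> space (torus N) \<Longrightarrow> \<bar>g x\<bar> \<le> B"
      using coord_lipschitz_bounded[OF L] by blast
    have "integrable \<mu> g"
      using m B by (intro integrable_bounded) (auto simp: sp)
    then have "(\<integral>x. g x \<partial>\<mu>) - g x0 = (\<integral>x. g x - g x0 \<partial>\<mu>)"
      by (simp add: prob_space)
    also have "\<bar>\<dots>\<bar> \<le> (\<Sum>i=1..N. L i) / 2"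
      using m coord_lipschitz_oscillation[OF L _ x0] by (intro abs_integral_le_bound) (auto simp: sp)
    finally show ?thesis .
  qed
  show ?thesis using *[OF \<mu>(1)] *[OF \<mu>(2)] by linarith
qed

lemma coord_lipschitz_divide:
  assumes "coord_lipschitz N L g" "0 < S"
  shows "coord_lipschitz N (\<lambda>i. L i / S) (\<lambda>x. g x / S)"
  using assms by (auto simp: coord_lipschitz_def divide_right_mono abs_divide simp flip: diff_divide_distrib)

lemma integral_diff_le_W1_of_LipN:
  assumes \<mu>: "\<mu>1 \<in> space (prob_algebra (torus N))" "\<mu>2 \<in> space (prob_algebra (torus N))"
    and g: "LipN N g \<le> 1"
  shows "(\<integral>x. g x \<partial>\<mu>1) - (\<integral>x. g x \<partial>\<mu>2) \<le> W1 N \<mu>1 \<mu>2"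
proof -
  have "bdd_above ((\<lambda>g. (\<integral>x. g x \<partial>\<mu>1) - (\<integral>x. g x \<partial>\<mu>2)) ` {g. LipN N g \<le> 1})"
  proof (rule bdd_aboveI2[of _ _ 1])
    fix g assume "g \<in> {g. LipN N g \<le> 1}"
    then obtain L where "coord_lipschitz N L g" "(\<Sum>i=1..N. L i) \<le> 1"
      using coord_lipschitz_of_LipN by blast
    then show "(\<integral>x. g x \<partial>\<mu>1) - (\<integral>x. g x \<partial>\<mu>2) \<le> 1"
      using coord_lipschitz_integral_diff_le[OF _ \<mu>] by (blast intro: order_trans)
  qed
  then show ?thesis
    unfolding W1_def by (rule cSUP_upper[rotated]) (use g in simp)
qed

text \<open>Homogeneity: \<open>g\<close> divided by the sum \<open>S\<close> of its constants is
  admissible in \<open>W1\<close>. For \<open>S = 0\<close> no normalisation is possible, but then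
  the a priori bound is already 0.\<close>

lemma integral_diff_le_W1:
  assumes L: "coord_lipschitz N L g"
    and \<mu>: "\<mu>1 \<in> space (prob_algebra (torus N))" "\<mu>2 \<in> space (prob_algebra (torus N))"
  shows "(\<integral>x. g x \<partial>\<mu>1) - (\<integral>x. g x \<partial>\<mu>2) \<le> (\<Sum>i=1..N. L i) * W1 N \<mu>1 \<mu>2"
proof -
  define S where "S = (\<Sum>i=1..N. L i)"
  have "0 \<le> S" using L by (auto simp: S_def coord_lipschitz_def intro!: sum_nonneg)
  then consider "S = 0" | "S > 0" by linarith
  then show ?thesis
  proof cases
    case 1
    then show ?thesis
      using coord_lipschitz_integral_diff_le[OF L \<mu>] by (simp add: S_def)
  next
    case 2
    have "LipN N (\<lambda>x. g x / S) \<le> ennreal (\<Sum>i=1..N. L i / S)"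
      by (intro LipN_le_of_coord_lipschitz coord_lipschitz_divide L 2)
    also have "(\<Sum>i=1..N. L i / S) = 1"
      using 2 by (simp add: S_def flip: sum_divide_distrib)
    finally have g: "LipN N (\<lambda>x. g x / S) \<le> 1" by simp
    then have "(\<integral>x. g x / S \<partial>\<mu>1) - (\<integral>x. g x / S \<partial>\<mu>2) \<le> W1 N \<mu>1 \<mu>2"
      by (rule integral_diff_le_W1_of_LipN[OF \<mu>])
    then have "((\<integral>x. g x \<partial>\<mu>1) - (\<integral>x. g x \<partial>\<mu>2)) / S \<le> W1 N \<mu>1 \<mu>2"
      by (simp add: diff_divide_distrib)
    then show ?thesis using 2 by (simp add: S_def field_simps)
  qed
qed

lemma coord_lipschitz_zero: "coord_lipschitz N (\<lambda>_. 0) (\<lambda>_. 0)"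
  by (simp add: coord_lipschitz_def)

lemma W1_leI:
  assumes "\<And>g L. coord_lipschitz N L g \<Longrightarrow> (\<Sum>i=1..N. L i) \<le> 1 \<Longrightarrow>
      (\<integral>x. g x \<partial>\<mu>1) - (\<integral>x. g x \<partial>\<mu>2) \<le> w"
  shows "W1 N \<mu>1 \<mu>2 \<le> w"
  unfolding W1_def
proof (rule cSUP_least)
  have "LipN N (\<lambda>_. 0) \<le> 1"
    using LipN_le_of_coord_lipschitz[OF coord_lipschitz_zero, of N] by simp
  then show "{g. LipN N g \<le> 1} \<noteq> {}" by blast
  fix g assume "g \<in> {g. LipN N g \<le> 1}"
  then show "(\<integral>x. g x \<partial>\<mu>1) - (\<integral>x. g x \<partial>\<mu>2) \<le> w"
    using assms coord_lipschitz_of_LipN by blast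
qed

lemma W1_nonneg:
  assumes \<mu>: "\<mu>1 \<in> space (prob_algebra (torus N))" "\<mu>2 \<in> space (prob_algebra (torus N))"
  shows "0 \<le> W1 N \<mu>1 \<mu>2"
proof -
  have "LipN N (\<lambda>_. 0) \<le> 1"
    using LipN_le_of_coord_lipschitz[OF coord_lipschitz_zero, of N] by simp
  from integral_diff_le_W1_of_LipN[OF \<mu> this] show ?thesis by simp
qed

section \<open>Averaging the noise over random drifts\<close>

text \<open>The law of \<open>N\<close> coordinates that are independent given \<open>u\<close>, the
  \<open>j\<close>-th having law \<open>noise p (F j u)\<close>, with \<open>u\<close> drawn from
  \<mu>. Both \<open>transfer_N\<close> and the powers of \<open>transfer_self_consistent\<close>
  have this form and differ only in the drift \<open>F\<close> and the measure of
  \<open>u\<close>.\<close>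

definition mix :: "(real \<Rightarrow> real) \<Rightarrow> nat \<Rightarrow> (nat \<Rightarrow> 'u \<Rightarrow> real) \<Rightarrow> 'u measure \<Rightarrow> (nat \<Rightarrow> circle) measure"
  where "mix p N F \<mu> = density (torus_lebesgue N)
    (\<lambda>x. \<integral>\<^sup>+u. (\<Prod>j=1..N. ennreal (p (circle_coord (x j) - F j u))) \<partial>\<mu>)"

text \<open>The common abstraction of the two kinds of test functions: averaged over the noise in
  coordinate \<open>j\<close>, the function is Lipschitz with constant \<open>E j\<close> in the
  shift of that noise. Lipschitz functions satisfy it through the lower bound \<open>c\<close>,
  bounded ones through the variation of \<open>p\<close>.\<close>

definition noise_lipschitz :: "(real \<Rightarrow> real) \<Rightarrow> nat \<Rightarrow> (nat \<Rightarrow> real) \<Rightarrow> ((nat \<Rightarrow> circle) \<Rightarrow> real) \<Rightarrow> bool"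
  where "noise_lipschitz p N E g \<longleftrightarrow>
    g \<in> borel_measurable (torus N) \<and> (\<exists>B. \<forall>x\<in>space (torus N). \<bar>g x\<bar> \<le> B) \<and>
    (\<forall>j\<in>{1..N}. 0 \<le> E j \<and> (\<forall>x\<in>space (torus N). \<forall>s t.
      \<bar>(\<integral>y. g (x(j := y)) \<partial>noise p s) - (\<integral>y. g (x(j := y)) \<partial>noise p t)\<bar> \<le> E j * \<bar>s - t\<bar>))"

lemma sets_mix [simp, measurable_cong]: "sets (mix p N F \<mu>) = sets (torus N)"
  by (simp add: mix_def cong: sets_PiM_cong)

lemma space_mix [simp]: "space (mix p N F \<mu>) = space (torus N)"
  using sets_mix by (rule sets_eq_imp_space_eq)

lemma sets_noise_PiM: "sets (PiM I (\<lambda>j. noise p (a j))) = sets (PiM I (\<lambda>_. borel))"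
  by (intro sets_PiM_cong) auto

lemma space_noise_PiM [simp]: "space (PiM I (\<lambda>j. noise p (a j))) = space (PiM I (\<lambda>_. borel))"
  using sets_noise_PiM by (rule sets_eq_imp_space_eq)

lemma sets_torus_lebesgue: "sets (torus_lebesgue N) = sets (torus N)"
  by (intro sets_PiM_cong) auto

text \<open>Adding the bound \<open>B\<close> makes the integrand nonnegative; this transports
  Tonelli's theorem, proved for \<open>ennreal\<close>, to bounded real functions.\<close>

lemma (in prob_space) nn_integral_add_bound:
  fixes g :: "'a \<Rightarrow> real"
  assumes "g \<in> borel_measurable M" "\<And>x. x \<in> space M \<Longrightarrow> \<bar>g x\<bar> \<le> B"
  shows "(\<integral>\<^sup>+x. ennreal (g x + B) \<partial>M) = ennreal ((\<integral>x. g x \<partial>M) + B)"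
proof -
  have i: "integrable M g" by (rule integrable_bounded[OF assms])
  have "0 \<le> g x + B" if "x \<in> space M" for x
    using assms(2)[OF that] by linarith
  then have "(\<integral>\<^sup>+x. ennreal (g x + B) \<partial>M) = ennreal (\<integral>x. g x + B \<partial>M)"
    using i by (intro nn_integral_eq_integral) auto
  then show ?thesis using i prob_space by simp
qed

lemma measurable_fun_upd_torus:
  assumes "x \<in> space (torus N)" "j \<in> {1..N}"
  shows "(\<lambda>y. x(j := y)) \<in> measurable borel (torus N)"
  using assms by (intro measurable_fun_upd[where J="{1..N}"]) auto

context
  fixes p :: "real \<Rightarrow> real"
  assumes p: "periodic_density p"
begin

interpretation prob_space "noise p a" for a
  by (rule prob_space_noise[OF p])

lemma prob_space_noise_PiM: "prob_space (PiM I (\<lambda>j. noise p (a j)))"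
  by (intro prob_space_PiM prob_space_noise p)

lemma noise_PiM_eq_density:
  "PiM {1..N} (\<lambda>j. noise p (a j)) =
    density (torus_lebesgue N) (\<lambda>x. \<Prod>j=1..N. ennreal (p (circle_coord (x j) - a j)))"
  unfolding noise_def
proof (rule density_PiM[symmetric])
  note [measurable] = measurable_p[OF p]
  show "(\<lambda>y. ennreal (p (circle_coord y - a i))) \<in> borel_measurable circle_lebesgue" for i
    by measurable
  show "sigma_finite_measure circle_lebesgue"
    by (intro prob_space_imp_sigma_finite prob_space_circle_lebesgue)
  show "sigma_finite_measure (density circle_lebesgue (\<lambda>y. ennreal (p (circle_coord y - a i))))" for i
    using prob_space_imp_sigma_finite[OF prob_space_noise[OF p, of "a i"]] by (simp add: noise_def)
qed simp

lemma measurable_mix_kernel: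
  assumes F: "\<And>j. j \<in> {1..N} \<Longrightarrow> F j \<in> borel_measurable \<mu>"
  shows "(\<lambda>(x, u). \<Prod>j=1..N. ennreal (p (circle_coord (x j) - F j u)))
    \<in> borel_measurable (torus_lebesgue N \<Otimes>\<^sub>M \<mu>)"
  unfolding split_beta
proof (rule borel_measurable_prod_ennreal)
  fix j assume j: "j \<in> {1..N}"
  note [measurable] = measurable_p[OF p] F[OF j]
  have [measurable]: "(\<lambda>z. fst z j) \<in> borel_measurable (torus_lebesgue N \<Otimes>\<^sub>M \<mu>)"
    using measurable_compose[OF measurable_fst measurable_component_singleton[OF j, of "\<lambda>_. circle_lebesgue"]]
    by (simp cong: measurable_cong_sets)
  show "(\<lambda>z. ennreal (p (circle_coord (fst z j) - F j (snd z)))) \<in> borel_measurable (torus_lebesgue N \<Otimes>\<^sub>M \<mu>)"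
    by measurable
qed

text \<open>Tonelli for the joint density \<open>K x u\<close> on
  \<open>torus_lebesgue N \<Otimes>\<^sub>M \<mu>\<close>. Measurability in \<open>u\<close> of the
  inner integral is read off from the same density representation.\<close>

lemma nn_integral_mix:
  assumes \<mu>: "prob_space \<mu>"
    and F: "\<And>j. j \<in> {1..N} \<Longrightarrow> F j \<in> borel_measurable \<mu>"
    and G: "G \<in> borel_measurable (torus N)"
  shows "(\<integral>\<^sup>+x. G x \<partial>mix p N F \<mu>) = (\<integral>\<^sup>+u. (\<integral>\<^sup>+x. G x \<partial>PiM {1..N} (\<lambda>j. noise p (F j u))) \<partial>\<mu>)"
    and "(\<lambda>u. \<integral>\<^sup>+x. G x \<partial>PiM {1..N} (\<lambda>j. noise p (F j u))) \<in> borel_measurable \<mu>"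
proof -
  interpret \<mu>: prob_space \<mu> by fact
  interpret T: prob_space "torus_lebesgue N"
    by (intro prob_space_PiM prob_space_circle_lebesgue)
  interpret T\<mu>: pair_sigma_finite "torus_lebesgue N" \<mu> ..
  define K where "K = (\<lambda>x u. \<Prod>j=1..N. ennreal (p (circle_coord (x j) - F j u)))"
  have K [measurable]: "(\<lambda>(x, u). K x u) \<in> borel_measurable (torus_lebesgue N \<Otimes>\<^sub>M \<mu>)"
    unfolding K_def by (rule measurable_mix_kernel[OF F])
  have Gm [measurable]: "G \<in> borel_measurable (torus_lebesgue N)"
    using G by (simp add: measurable_cong_sets[OF sets_torus_lebesgue refl])
  have *: "(\<integral>\<^sup>+x. G x \<partial>PiM {1..N} (\<lambda>j. noise p (F j u))) = (\<integral>\<^sup>+x. K x u * G x \<partial>torus_lebesgue N)"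
    if "u \<in> space \<mu>" for u
    unfolding noise_PiM_eq_density
    using measurable_Pair1[OF K that] Gm by (subst nn_integral_density) (simp_all add: K_def)
  have K\<mu>: "(\<lambda>x. \<integral>\<^sup>+u. K x u \<partial>\<mu>) \<in> borel_measurable (torus_lebesgue N)"
    by measurable
  have "(\<integral>\<^sup>+x. G x \<partial>mix p N F \<mu>) = (\<integral>\<^sup>+x. (\<integral>\<^sup>+u. K x u \<partial>\<mu>) * G x \<partial>torus_lebesgue N)"
    unfolding mix_def using K\<mu> Gm by (subst nn_integral_density) (simp_all add: K_def)
  also have "\<dots> = (\<integral>\<^sup>+x. (\<integral>\<^sup>+u. K x u * G x \<partial>\<mu>) \<partial>torus_lebesgue N)"
    by (intro nn_integral_cong nn_integral_multc[symmetric]) auto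
  also have "\<dots> = (\<integral>\<^sup>+u. (\<integral>\<^sup>+x. K x u * G x \<partial>torus_lebesgue N) \<partial>\<mu>)"
    by (rule T\<mu>.Fubini'[symmetric]) measurable
  finally show "(\<integral>\<^sup>+x. G x \<partial>mix p N F \<mu>) = (\<integral>\<^sup>+u. (\<integral>\<^sup>+x. G x \<partial>PiM {1..N} (\<lambda>j. noise p (F j u))) \<partial>\<mu>)"
    by (simp add: * cong: nn_integral_cong)
  have "(\<lambda>u. \<integral>\<^sup>+x. K x u * G x \<partial>torus_lebesgue N) \<in> borel_measurable \<mu>"
    by measurable
  then show "(\<lambda>u. \<integral>\<^sup>+x. G x \<partial>PiM {1..N} (\<lambda>j. noise p (F j u))) \<in> borel_measurable \<mu>"
    by (subst measurable_cong[OF *])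
qed

lemma prob_space_mix:
  assumes \<mu>: "prob_space \<mu>"
    and F: "\<And>j. j \<in> {1..N} \<Longrightarrow> F j \<in> borel_measurable \<mu>"
  shows "prob_space (mix p N F \<mu>)"
proof (rule prob_spaceI)
  interpret \<mu>: prob_space \<mu> by fact
  have 1: "(\<integral>\<^sup>+x. 1 \<partial>PiM {1..N} (\<lambda>j. noise p (F j u))) = 1" for u
    using prob_space.emeasure_space_1[OF prob_space_noise_PiM] by simp
  have "emeasure (mix p N F \<mu>) (space (mix p N F \<mu>)) = (\<integral>\<^sup>+x. 1 \<partial>mix p N F \<mu>)"
    by simp
  also have "\<dots> = 1"
    by (subst nn_integral_mix[OF \<mu> F]) (simp_all only: 1, auto simp: \<mu>.emeasure_space_1)
  finally show "emeasure (mix p N F \<mu>) (space (mix p N F \<mu>)) = 1" .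
qed

text \<open>The nonnegative version is applied to \<open>g + B\<close>. As \<open>B\<close> bounds
  all integrals of \<open>g\<close> involved, the shifted values are nonnegative, so
  \<open>ennreal\<close> values determine the real ones and \<open>B\<close> can be subtracted
  again; measurability of the inner integral returns through \<open>enn2real\<close> in the same
  way.\<close>

lemma integral_mix:
  fixes g :: "(nat \<Rightarrow> circle) \<Rightarrow> real"
  assumes \<mu>: "prob_space \<mu>"
    and F: "\<And>j. j \<in> {1..N} \<Longrightarrow> F j \<in> borel_measurable \<mu>"
    and g: "g \<in> borel_measurable (torus N)" "\<And>x. x \<in> space (torus N) \<Longrightarrow> \<bar>g x\<bar> \<le> B"
  shows "(\<integral>x. g x \<partial>mix p N F \<mu>) = (\<integral>u. (\<integral>x. g x \<partial>PiM {1..N} (\<lambda>j. noise p (F j u))) \<partial>\<mu>)"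
    and "integrable \<mu> (\<lambda>u. \<integral>x. g x \<partial>PiM {1..N} (\<lambda>j. noise p (F j u)))"
proof -
  interpret \<mu>: prob_space \<mu> by fact
  interpret mix: prob_space "mix p N F \<mu>" by (rule prob_space_mix[OF \<mu> F])
  let ?K = "\<lambda>u. PiM {1..N} (\<lambda>j. noise p (F j u))"
  have gK: "g \<in> borel_measurable (?K u)" for u
    using g(1) by (simp add: measurable_cong_sets[OF sets_noise_PiM refl])
  have IB: "\<bar>\<integral>x. g x \<partial>?K u\<bar> \<le> B" for u
    by (rule prob_space.abs_integral_le_bound[OF prob_space_noise_PiM gK]) (use g(2) in auto)
  have K: "(\<integral>\<^sup>+x. ennreal (g x + B) \<partial>?K u) = ennreal ((\<integral>x. g x \<partial>?K u) + B)" for u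
    using gK g(2) by (intro prob_space.nn_integral_add_bound prob_space_noise_PiM) auto
  have gB: "(\<lambda>x. ennreal (g x + B)) \<in> borel_measurable (torus N)"
    using g(1) by measurable
  have enn: "(\<lambda>r. enn2real r - B) \<in> borel_measurable borel"
    by measurable
  have "(\<lambda>u. enn2real (ennreal ((\<integral>x. g x \<partial>?K u) + B)) - B) \<in> borel_measurable \<mu>"
    using measurable_compose[OF nn_integral_mix(2)[where F=F, OF \<mu> F gB] enn] unfolding K .
  moreover have "0 \<le> (\<integral>x. g x \<partial>?K u) + B" for u using IB[of u] by linarith
  ultimately have m: "(\<lambda>u. \<integral>x. g x \<partial>?K u) \<in> borel_measurable \<mu>"
    by simp
  show "integrable \<mu> (\<lambda>u. \<integral>x. g x \<partial>?K u)"
    by (rule \<mu>.integrable_bounded[OF m IB])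
  have "ennreal ((\<integral>x. g x \<partial>mix p N F \<mu>) + B) = (\<integral>\<^sup>+x. ennreal (g x + B) \<partial>mix p N F \<mu>)"
    using g by (intro mix.nn_integral_add_bound[symmetric]) (auto simp: measurable_cong_sets[OF sets_mix refl])
  also have "\<dots> = (\<integral>\<^sup>+u. ennreal ((\<integral>x. g x \<partial>?K u) + B) \<partial>\<mu>)"
    using nn_integral_mix(1)[where F=F, OF \<mu> F gB] unfolding K .
  also have "\<dots> = ennreal ((\<integral>u. (\<integral>x. g x \<partial>?K u) \<partial>\<mu>) + B)"
    by (rule \<mu>.nn_integral_add_bound[OF m IB])
  finally have *: "ennreal ((\<integral>x. g x \<partial>mix p N F \<mu>) + B) = ennreal ((\<integral>u. (\<integral>x. g x \<partial>?K u) \<partial>\<mu>) + B)" .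
  have "\<bar>\<integral>x. g x \<partial>mix p N F \<mu>\<bar> \<le> B"
    using g by (intro mix.abs_integral_le_bound) (auto simp: measurable_cong_sets[OF sets_mix refl])
  moreover have "\<bar>\<integral>u. (\<integral>x. g x \<partial>?K u) \<partial>\<mu>\<bar> \<le> B"
    by (rule \<mu>.abs_integral_le_bound[OF m IB])
  ultimately show "(\<integral>x. g x \<partial>mix p N F \<mu>) = (\<integral>u. (\<integral>x. g x \<partial>?K u) \<partial>\<mu>)"
    using * by (subst (asm) ennreal_inj) auto
qed

lemma noise_lipschitz_kernel_diff_le:
  assumes "noise_lipschitz p N E g"
  shows "\<bar>(\<integral>x. g x \<partial>PiM {1..N} (\<lambda>j. noise p (a j))) - (\<integral>x. g x \<partial>PiM {1..N} (\<lambda>j. noise p (b j)))\<bar>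
    \<le> (\<Sum>j=1..N. E j * \<bar>a j - b j\<bar>)"
proof -
  obtain B where "\<forall>x\<in>space (torus N). \<bar>g x\<bar> \<le> B"
    using assms unfolding noise_lipschitz_def by blast
  then show ?thesis
    using assms by (intro PiM_integral_diff_le[where S="\<lambda>_. borel" and B=B])
      (auto simp: noise_lipschitz_def prob_space_noise[OF p])
qed

text \<open>Both mixtures draw the same \<open>u\<close>, so the kernels can be compared for each
  \<open>u\<close> separately and the drift differences averaged afterwards. The bound
  \<open>D\<close> makes these differences integrable.\<close>

lemma integral_mix_diff_le:
  assumes \<mu>: "prob_space \<mu>"
    and F: "\<And>j. j \<in> {1..N} \<Longrightarrow> F j \<in> borel_measurable \<mu>"
    and F': "\<And>j. j \<in> {1..N} \<Longrightarrow> F' j \<in> borel_measurable \<mu>"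
    and D: "\<And>j u. j \<in> {1..N} \<Longrightarrow> u \<in> space \<mu> \<Longrightarrow> \<bar>F j u - F' j u\<bar> \<le> D"
    and g: "noise_lipschitz p N E g"
  shows "(\<integral>x. g x \<partial>mix p N F \<mu>) - (\<integral>x. g x \<partial>mix p N F' \<mu>)
    \<le> (\<Sum>j=1..N. E j * (\<integral>u. \<bar>F j u - F' j u\<bar> \<partial>\<mu>))"
proof -
  interpret \<mu>: prob_space \<mu> by fact
  obtain B where B: "\<And>x. x \<in> space (torus N) \<Longrightarrow> \<bar>g x\<bar> \<le> B"
    using g unfolding noise_lipschitz_def by blast
  have gm: "g \<in> borel_measurable (torus N)" using g by (simp add: noise_lipschitz_def)
  note i = integral_mix[where F=F, OF \<mu> F gm B] integral_mix[where F=F', OF \<mu> F' gm B]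
  have int: "integrable \<mu> (\<lambda>u. \<bar>F j u - F' j u\<bar>)" if "j \<in> {1..N}" for j
    using D[OF that] F[OF that] F'[OF that] by (intro \<mu>.integrable_bounded[where B=D]) auto
  have "(\<integral>x. g x \<partial>mix p N F \<mu>) - (\<integral>x. g x \<partial>mix p N F' \<mu>)
      = (\<integral>u. (\<integral>x. g x \<partial>PiM {1..N} (\<lambda>j. noise p (F j u))) - (\<integral>x. g x \<partial>PiM {1..N} (\<lambda>j. noise p (F' j u))) \<partial>\<mu>)"
    using i by simp
  also have "\<dots> \<le> (\<integral>u. (\<Sum>j=1..N. E j * \<bar>F j u - F' j u\<bar>) \<partial>\<mu>)"
  proof (rule integral_mono)
    fix u
    show "(\<integral>x. g x \<partial>PiM {1..N} (\<lambda>j. noise p (F j u))) - (\<integral>x. g x \<partial>PiM {1..N} (\<lambda>j. noise p (F' j u)))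
        \<le> (\<Sum>j=1..N. E j * \<bar>F j u - F' j u\<bar>)"
      using noise_lipschitz_kernel_diff_le[OF g, of "\<lambda>j. F j u" "\<lambda>j. F' j u"] by linarith
  qed (use i int in \<open>auto intro!: Bochner_Integration.integrable_sum\<close>)
  also have "\<dots> = (\<Sum>j=1..N. E j * (\<integral>u. \<bar>F j u - F' j u\<bar> \<partial>\<mu>))"
    using int by (subst Bochner_Integration.integral_sum) auto
  finally show ?thesis .
qed

lemma noise_lipschitz_of_coord_lipschitz:
  assumes L: "coord_lipschitz N L g" and c: "\<And>x. c \<le> p x" "c \<le> 1"
  shows "noise_lipschitz p N (\<lambda>i. (1 - c) * L i) g"
  unfolding noise_lipschitz_def
proof (intro conjI ballI allI)
  show gm: "g \<in> borel_measurable (torus N)"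
    by (rule measurable_coord_lipschitz[OF L])
  obtain B where B: "\<And>x. x \<in> space (torus N) \<Longrightarrow> \<bar>g x\<bar> \<le> B"
    using coord_lipschitz_bounded[OF L] by blast
  then show "\<exists>B. \<forall>x\<in>space (torus N). \<bar>g x\<bar> \<le> B" by blast
  fix j assume j: "j \<in> {1..N}"
  then have Lj: "0 \<le> L j" using L by (simp add: coord_lipschitz_def)
  then show "0 \<le> (1 - c) * L j" using c by simp
  fix x s t assume x: "x \<in> space (torus N)"
  have upd: "x(j := y) \<in> {1..N} \<rightarrow>\<^sub>E UNIV" for y
    using x j by (auto simp: space_torus PiE_iff extensional_def)
  have "\<bar>g (x(j := y)) - g (x(j := z))\<bar> \<le> L j * dist y z" for y z
    using L upd[of y] j unfolding coord_lipschitz_def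
    by (metis fun_upd_same fun_upd_upd)
  then show "\<bar>(\<integral>y. g (x(j := y)) \<partial>noise p s) - (\<integral>y. g (x(j := y)) \<partial>noise p t)\<bar> \<le> (1 - c) * L j * \<bar>s - t\<bar>"
    using measurable_compose[OF measurable_fun_upd_torus[OF x j] gm] B[of "x(j := _)"] upd Lj c
    by (intro noise_Lipschitz[OF p, where B=B]) (auto simp: space_torus)
qed

text \<open>Coordinates beyond \<open>k\<close> do not enter \<open>g\<close>, so their noise
  integrates out to the same value for every shift and their constants are 0. The sum of the
  constants therefore stays bounded independently of \<open>N\<close>.\<close>

lemma noise_lipschitz_of_bounded_variation:
  assumes V: "\<And>(n::nat) (t::nat \<Rightarrow> real). mono_on {..n} t \<Longrightarrow> t ` {..n} \<subseteq> {0..1} \<Longrightarrow>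
      (\<Sum>i<n. \<bar>p (t (Suc i)) - p (t i)\<bar>) \<le> V"
    and gm: "g \<in> borel_measurable (torus N)" and B: "\<And>x. x \<in> space (torus N) \<Longrightarrow> \<bar>g x\<bar> \<le> 1"
    and dep: "\<And>x y j. j \<in> {1..N} \<Longrightarrow> k < j \<Longrightarrow> g (x(j := y)) = g x"
  shows "noise_lipschitz p N (\<lambda>j. if j \<le> k then 4 * V + 2 else 0) g"
  unfolding noise_lipschitz_def
proof (intro conjI ballI allI)
  show "\<exists>B. \<forall>x\<in>space (torus N). \<bar>g x\<bar> \<le> B" using B by blast
  have "0 \<le> V" using V[of 0 "\<lambda>_. 0"] by (simp add: mono_on_def)
  then show "0 \<le> (if j \<le> k then 4 * V + 2 else 0)" for j by simp
  fix j x s t assume j: "j \<in> {1..N}" and x: "x \<in> space (torus N)"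
  have upd: "x(j := y) \<in> space (torus N)" for y
    using x j by (auto simp: space_torus PiE_iff extensional_def)
  show "\<bar>(\<integral>y. g (x(j := y)) \<partial>noise p s) - (\<integral>y. g (x(j := y)) \<partial>noise p t)\<bar>
      \<le> (if j \<le> k then 4 * V + 2 else 0) * \<bar>s - t\<bar>"
  proof (cases "j \<le> k")
    case True
    have "\<bar>(\<integral>y. g (x(j := y)) \<partial>noise p s) - (\<integral>y. g (x(j := y)) \<partial>noise p t)\<bar> \<le> (4 * V + 2) * \<bar>s - t\<bar>"
      using measurable_compose[OF measurable_fun_upd_torus[OF x j] gm] B[OF upd]
      by (intro noise_bounded_variation[OF p V]) auto
    then show ?thesis using True by simp
  next
    case False
    moreover have "measure (noise p s) UNIV = 1" for s
      using prob_space[of s] by simp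
    ultimately show ?thesis using dep[OF j] by simp
  qed
qed (rule gm)

end

section \<open>Mean-field dynamics\<close>

definition drift :: "(circle \<Rightarrow> real) \<Rightarrow> (circle \<times> circle \<Rightarrow> real) \<Rightarrow> nat \<Rightarrow> nat \<Rightarrow> (nat \<Rightarrow> circle) \<Rightarrow> real"
  where "drift f h N j u = f (u j) + 1 / real N * (\<Sum>k=1..N. h (u j, u k))"

definition mean_drift :: "(circle \<Rightarrow> real) \<Rightarrow> (circle \<times> circle \<Rightarrow> real) \<Rightarrow> circle measure \<Rightarrow> circle \<Rightarrow> real"
  where "mean_drift f h \<nu> v = f v + (\<integral>w. h (v, w) \<partial>\<nu>)"

lemma transfer_N_eq_mix: "transfer_N f h p N \<mu> = mix p N (drift f h N) \<mu>"
  by (simp add: transfer_N_def mix_def drift_def diff_diff_eq)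

text \<open>The suprema \<open>Lip\<close>, \<open>Lip1\<close> and \<open>Lip2\<close> enter the
  argument only through the inequalities they satisfy; \<open>Lf\<close>, \<open>L1\<close> and
  \<open>L2\<close> stand for them.\<close>

locale mean_field =
  fixes f :: "circle \<Rightarrow> real" and h :: "circle \<times> circle \<Rightarrow> real" and p :: "real \<Rightarrow> real"
    and Lf L1 L2 :: real
  assumes p: "periodic_density p"
    and f_measurable [measurable]: "f \<in> borel_measurable borel"
    and h_measurable [measurable]: "h \<in> borel_measurable (borel \<Otimes>\<^sub>M borel)"
    and f_lip: "\<And>u u'. \<bar>f u - f u'\<bar> \<le> Lf * dist u u'"
    and h_lip1: "\<And>u u' v. \<bar>h (u, v) - h (u', v)\<bar> \<le> L1 * dist u u'"
    and h_lip2: "\<And>u v v'. \<bar>h (u, v) - h (u, v')\<bar> \<le> L2 * dist v v'"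
    and nonneg: "0 \<le> Lf" "0 \<le> L1" "0 \<le> L2"
begin

lemma drift_measurable:
  assumes "j \<in> {1..N}"
  shows "drift f h N j \<in> borel_measurable (torus N)"
proof -
  have [measurable]: "(\<lambda>u. u k) \<in> borel_measurable (torus N)" if "k \<in> {1..N}" for k
    using that by (rule measurable_component_singleton)
  have "(\<lambda>u. h (u j, u k)) \<in> borel_measurable (torus N)" if "k \<in> {1..N}" for k
    using that assms by measurable
  moreover have "(\<lambda>u. f (u j)) \<in> borel_measurable (torus N)"
    using assms by measurable
  ultimately show ?thesis
    unfolding drift_def by (intro borel_measurable_add borel_measurable_times borel_measurable_sum) auto
qed

lemma h_osc: "\<bar>h (v, w) - h (v, w')\<bar> \<le> L2"
proof -
  have "\<bar>h (v, w) - h (v, w')\<bar> \<le> L2 * dist w w'" by (rule h_lip2)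
  also have "\<dots> \<le> L2 * 1"
    using dist_circle_le_half[of w w'] nonneg by (intro mult_left_mono) auto
  finally show ?thesis by simp
qed

lemma integrable_h:
  assumes "\<nu> \<in> space (prob_algebra borel)"
  shows "integrable \<nu> (\<lambda>w. h (v, w))"
proof -
  interpret prob_space \<nu> using assms by (simp add: space_prob_algebra)
  have s: "sets \<nu> = sets borel" using assms by (simp add: space_prob_algebra)
  note [measurable_cong] = s
  have "(\<lambda>w. h (v, w)) \<in> borel_measurable \<nu>" by measurable
  moreover have "\<bar>h (v, w)\<bar> \<le> \<bar>h (v, v)\<bar> + L2" for w
    using h_osc[of v w v] by linarith
  ultimately show ?thesis by (rule integrable_bounded)
qed

lemma mean_h_measurable:
  assumes "\<nu> \<in> space (prob_algebra borel)"
  shows "(\<lambda>v. \<integral>w. h (v, w) \<partial>\<nu>) \<in> borel_measurable borel"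
proof -
  interpret prob_space \<nu> using assms by (simp add: space_prob_algebra)
  have s: "sets \<nu> = sets borel" using assms by (simp add: space_prob_algebra)
  note [measurable_cong] = s
  show ?thesis by measurable
qed

lemma mean_drift_measurable:
  assumes "\<nu> \<in> space (prob_algebra borel)"
  shows "mean_drift f h \<nu> \<in> borel_measurable borel"
  unfolding mean_drift_def using mean_h_measurable[OF assms] by measurable

lemma h_deviation_le:
  assumes "\<nu> \<in> space (prob_algebra borel)"
  shows "\<bar>h (v, w) - (\<integral>w. h (v, w) \<partial>\<nu>)\<bar> \<le> L2"
proof -
  interpret prob_space \<nu> using assms by (simp add: space_prob_algebra)
  have "h (v, w) - (\<integral>w'. h (v, w') \<partial>\<nu>) = (\<integral>w'. h (v, w) - h (v, w') \<partial>\<nu>)"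
    using integrable_h[OF assms, of v] prob_space by simp
  also have "\<bar>\<dots>\<bar> \<le> L2"
    using integrable_h[OF assms, of v] h_osc by (intro abs_integral_le_bound) auto
  finally show ?thesis .
qed

lemma transfer_N_prob:
  assumes "\<mu> \<in> space (prob_algebra (torus N))"
  shows "transfer_N f h p N \<mu> \<in> space (prob_algebra (torus N))"
proof -
  have s: "sets \<mu> = sets (torus N)" and "prob_space \<mu>"
    using assms by (auto simp: space_prob_algebra)
  then have "prob_space (mix p N (drift f h N) \<mu>)"
    using drift_measurable by (intro prob_space_mix[OF p]) (simp_all only: measurable_cong_sets[OF s refl])
  then show ?thesis
    by (simp add: transfer_N_eq_mix space_prob_algebra)
qed

text \<open>By Tonelli: a shifted noise density has mass 1 whatever the drift, and \<nu> averages
  these masses.\<close>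

lemma transfer_self_consistent_prob:
  assumes \<nu>: "\<nu> \<in> space (prob_algebra borel)"
  shows "transfer_self_consistent f h p \<nu> \<in> space (prob_algebra borel)"
proof -
  interpret \<nu>: prob_space \<nu> using \<nu> by (simp add: space_prob_algebra)
  interpret T: prob_space circle_lebesgue by (rule prob_space_circle_lebesgue)
  interpret T\<nu>: pair_sigma_finite circle_lebesgue \<nu> ..
  have s: "sets \<nu> = sets borel" using \<nu> by (simp add: space_prob_algebra)
  note [measurable_cong] = s
  note [measurable] = mean_drift_measurable[OF \<nu>] measurable_p[OF p]
  have eq: "transfer_self_consistent f h p \<nu>
      = density circle_lebesgue (\<lambda>x. \<integral>\<^sup>+u. ennreal (p (circle_coord x - mean_drift f h \<nu> u)) \<partial>\<nu>)"
    by (simp add: transfer_self_consistent_def mean_drift_def diff_diff_eq)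
  have "(\<integral>\<^sup>+x. (\<integral>\<^sup>+u. ennreal (p (circle_coord x - mean_drift f h \<nu> u)) \<partial>\<nu>) \<partial>circle_lebesgue)
      = (\<integral>\<^sup>+u. (\<integral>\<^sup>+x. ennreal (p (circle_coord x - mean_drift f h \<nu> u)) \<partial>circle_lebesgue) \<partial>\<nu>)"
    by (rule T\<nu>.Fubini'[symmetric]) measurable
  also have "\<dots> = 1"
    by (simp add: nn_integral_noise_density[OF p] \<nu>.emeasure_space_1)
  finally show ?thesis
    unfolding eq space_prob_algebra by (auto intro!: prob_spaceI simp: emeasure_density)
qed

text \<open>The density on the left is a product of \<open>N\<close> integrals over \<nu>. Read
  backwards, Fubini makes it one integral over the power of \<nu> in which the \<open>j\<close>-th
  factor depends on \<open>u j\<close> alone, which is a mixture with the averaged drift.\<close>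

lemma power_measure_transfer_eq_mix:
  assumes \<nu>: "\<nu> \<in> space (prob_algebra borel)"
  shows "power_measure (transfer_self_consistent f h p \<nu>) N
    = mix p N (\<lambda>j u. mean_drift f h \<nu> (u j)) (power_measure \<nu> N)"
proof -
  interpret \<nu>: prob_space \<nu> using \<nu> by (simp add: space_prob_algebra)
  interpret P: product_prob_space "\<lambda>_. \<nu>" "{1..N}" ..
  have s: "sets \<nu> = sets borel" using \<nu> by (simp add: space_prob_algebra)
  note [measurable_cong] = s
  note [measurable] = mean_drift_measurable[OF \<nu>] measurable_p[OF p]
  define q where "q = (\<lambda>x u. ennreal (p (circle_coord x - mean_drift f h \<nu> u)))"
  have [measurable]: "(\<lambda>(x, u). q x u) \<in> borel_measurable (borel \<Otimes>\<^sub>M \<nu>)"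
    unfolding q_def by measurable
  have eq: "transfer_self_consistent f h p \<nu> = density circle_lebesgue (\<lambda>x. \<integral>\<^sup>+u. q x u \<partial>\<nu>)"
    by (simp add: transfer_self_consistent_def mean_drift_def diff_diff_eq q_def)
  have "prob_space (density circle_lebesgue (\<lambda>x. \<integral>\<^sup>+u. q x u \<partial>\<nu>))"
    using transfer_self_consistent_prob[OF \<nu>] unfolding eq by (simp add: space_prob_algebra)
  then have "power_measure (transfer_self_consistent f h p \<nu>) N
      = density (torus_lebesgue N) (\<lambda>x. \<Prod>j=1..N. \<integral>\<^sup>+u. q (x j) u \<partial>\<nu>)"
    unfolding eq
    by (intro density_PiM[symmetric] prob_space_imp_sigma_finite prob_space_circle_lebesgue) auto
  also have "\<dots> = density (torus_lebesgue N) (\<lambda>x. \<integral>\<^sup>+u. (\<Prod>j=1..N. q (x j) (u j)) \<partial>power_measure \<nu> N)"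
    by (subst P.product_nn_integral_prod) auto
  finally show ?thesis by (simp add: mix_def q_def)
qed

lemma power_measure_prob:
  assumes "\<nu> \<in> space (prob_algebra borel)"
  shows "power_measure \<nu> N \<in> space (prob_algebra (torus N))"
  using assms by (auto simp: space_prob_algebra intro!: prob_space_PiM sets_PiM_cong)

text \<open>The first argument of \<open>h\<close> changes only if \<open>j = i\<close>, but then in
  all \<open>N\<close> summands, so the prefactor \<open>1 / N\<close> cancels. The second argument
  changes only in the summand \<open>k = i\<close>, which leaves \<open>L2 / N\<close>.\<close>

lemma drift_fun_upd_le:
  assumes j: "j \<in> {1..N}" and i: "i \<in> {1..N}"
  shows "\<bar>drift f h N j u - drift f h N j (u(i := y))\<bar>
    \<le> ((if j = i then Lf + L1 else 0) + L2 / real N) * dist (u i) y"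
proof -
  let ?u = "u(i := y)"
  have N: "0 < real N" using i by simp
  have "\<bar>h (u j, u k) - h (?u j, ?u k)\<bar> \<le> (if j = i then L1 else 0) * dist (u i) y + (if k = i then L2 * dist (u i) y else 0)" for k
  proof -
    have "\<bar>h (u j, u k) - h (?u j, u k)\<bar> \<le> (if j = i then L1 else 0) * dist (u i) y"
      using h_lip1[of "u j" "u k" "?u j"] by auto
    moreover have "\<bar>h (?u j, u k) - h (?u j, ?u k)\<bar> \<le> (if k = i then L2 * dist (u i) y else 0)"
      using h_lip2[of "?u j" "u k" "?u k"] by auto
    ultimately show ?thesis by linarith
  qed
  then have "\<bar>(\<Sum>k=1..N. h (u j, u k)) - (\<Sum>k=1..N. h (?u j, ?u k))\<bar>
      \<le> (\<Sum>k=1..N. (if j = i then L1 else 0) * dist (u i) y + (if k = i then L2 * dist (u i) y else 0))"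
    unfolding sum_subtractf[symmetric] by (intro order_trans[OF sum_abs sum_mono])
  also have "\<dots> = real N * ((if j = i then L1 else 0) * dist (u i) y) + L2 * dist (u i) y"
    using i by (simp add: sum.distrib)
  finally have "1 / real N * \<bar>(\<Sum>k=1..N. h (u j, u k)) - (\<Sum>k=1..N. h (?u j, ?u k))\<bar>
      \<le> 1 / real N * (real N * ((if j = i then L1 else 0) * dist (u i) y) + L2 * dist (u i) y)"
    using N by (intro mult_left_mono) auto
  also have "\<dots> = (if j = i then L1 else 0) * dist (u i) y + L2 / real N * dist (u i) y"
    using N by (simp add: field_simps)
  finally have "\<bar>1 / real N * (\<Sum>k=1..N. h (u j, u k)) - 1 / real N * (\<Sum>k=1..N. h (?u j, ?u k))\<bar>
      \<le> (if j = i then L1 else 0) * dist (u i) y + L2 / real N * dist (u i) y"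
    using N by (simp only: abs_mult flip: right_diff_distrib) simp
  moreover have "\<bar>f (u j) - f (?u j)\<bar> \<le> (if j = i then Lf else 0) * dist (u i) y"
    using f_lip[of "u j" "?u j"] by auto
  ultimately have "\<bar>drift f h N j u - drift f h N j ?u\<bar>
      \<le> (if j = i then Lf else 0) * dist (u i) y + ((if j = i then L1 else 0) * dist (u i) y + L2 / real N * dist (u i) y)"
    unfolding drift_def by linarith
  then show ?thesis by (auto simp: algebra_simps)
qed

text \<open>This function is the adjoint of \<open>transfer_N\<close> applied to \<open>g\<close>.
  Its constant for \<open>u i\<close> collects the effect of \<open>u i\<close> on all drifts
  \<open>j\<close>, weighted by \<open>E j\<close>: the diagonal part gives
  \<open>(Lf + L1) * E i\<close>, the mean-field part spreads \<open>L2 / N\<close> over the whole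
  sum.\<close>

lemma coord_lipschitz_kernel:
  assumes g: "noise_lipschitz p N E g"
  shows "coord_lipschitz N (\<lambda>i. (Lf + L1) * E i + L2 / real N * (\<Sum>j=1..N. E j))
    (\<lambda>u. \<integral>x. g x \<partial>PiM {1..N} (\<lambda>j. noise p (drift f h N j u)))"
  unfolding coord_lipschitz_def
proof (intro conjI ballI allI)
  have E: "0 \<le> E j" if "j \<in> {1..N}" for j using g that by (simp add: noise_lipschitz_def)
  fix i assume i: "i \<in> {1..N}"
  show "0 \<le> (Lf + L1) * E i + L2 / real N * (\<Sum>j=1..N. E j)"
    using nonneg E i by (intro add_nonneg_nonneg mult_nonneg_nonneg sum_nonneg) auto
  fix u :: "nat \<Rightarrow> circle" and y
  have "\<bar>(\<integral>x. g x \<partial>PiM {1..N} (\<lambda>j. noise p (drift f h N j u)))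
        - (\<integral>x. g x \<partial>PiM {1..N} (\<lambda>j. noise p (drift f h N j (u(i := y)))))\<bar>
      \<le> (\<Sum>j=1..N. E j * \<bar>drift f h N j u - drift f h N j (u(i := y))\<bar>)"
    by (rule noise_lipschitz_kernel_diff_le[OF p g])
  also have "\<dots> \<le> (\<Sum>j=1..N. E j * (((if j = i then Lf + L1 else 0) + L2 / real N) * dist (u i) y))"
    using E i by (intro sum_mono mult_left_mono drift_fun_upd_le) auto
  also have "\<dots> = (\<Sum>j=1..N. (if j = i then (Lf + L1) * E i * dist (u i) y else 0) + L2 / real N * dist (u i) y * E j)"
    by (intro sum.cong) (auto simp: algebra_simps)
  also have "\<dots> = ((Lf + L1) * E i + L2 / real N * (\<Sum>j=1..N. E j)) * dist (u i) y"
    unfolding sum.distrib sum_distrib_left[symmetric] using i by (simp add: algebra_simps)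
  finally show "\<bar>(\<integral>x. g x \<partial>PiM {1..N} (\<lambda>j. noise p (drift f h N j u)))
        - (\<integral>x. g x \<partial>PiM {1..N} (\<lambda>j. noise p (drift f h N j (u(i := y)))))\<bar>
      \<le> ((Lf + L1) * E i + L2 / real N * (\<Sum>j=1..N. E j)) * dist (u i) y" .
qed

text \<open>Of two distinct indices at least one differs from \<open>j\<close>; integrating out that
  coordinate first makes the correlation vanish.\<close>

lemma deviations_uncorrelated:
  assumes \<nu>: "\<nu> \<in> space (prob_algebra borel)" and I: "finite I" "j \<in> I" "k \<in> I" "l \<in> I" and "k \<noteq> l"
  defines "Z \<equiv> \<lambda>k u. h (u j, u k) - (\<integral>w. h (u j, w) \<partial>\<nu>)"
  shows "(\<integral>u. Z k u * Z l u \<partial>PiM I (\<lambda>_. \<nu>)) = 0"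
proof -
  interpret \<nu>: prob_space \<nu> using \<nu> by (simp add: space_prob_algebra)
  interpret P: product_prob_space "\<lambda>_. \<nu>" I ..
  have s: "sets \<nu> = sets borel" using \<nu> by (simp add: space_prob_algebra)
  note [measurable_cong] = s
  note [measurable] = mean_h_measurable[OF \<nu>]
  have Zm: "Z k \<in> borel_measurable (PiM I (\<lambda>_. \<nu>))" if "k \<in> I" for k
  proof -
    have [measurable]: "(\<lambda>u. u i) \<in> borel_measurable (PiM I (\<lambda>_. \<nu>))" if "i \<in> I" for i
      using measurable_component_singleton[OF that, of "\<lambda>_. \<nu>"] by (simp add: measurable_cong_sets[OF refl s])
    show ?thesis unfolding Z_def using that I by measurable
  qed
  have *: "(\<integral>u. Z k u * Z l u \<partial>PiM I (\<lambda>_. \<nu>)) = 0"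
    if kl: "k \<in> I" "l \<in> I" "k \<noteq> l" "l \<noteq> j" for k l
  proof -
    define J where "J = I - {l}"
    have J: "finite J" "l \<notin> J" "I = insert l J" using I kl by (auto simp: J_def)
    have "\<bar>Z k u * Z l u\<bar> \<le> L2 * L2" for u
      unfolding Z_def abs_mult by (intro mult_mono h_deviation_le \<nu>) (auto simp: nonneg)
    then have "integrable (PiM I (\<lambda>_. \<nu>)) (\<lambda>u. Z k u * Z l u)"
      using Zm kl by (intro P.integrable_bounded[where B="L2 * L2"]) auto
    then have "(\<integral>u. Z k u * Z l u \<partial>PiM I (\<lambda>_. \<nu>))
        = (\<integral>u. (\<integral>y. Z k (u(l := y)) * Z l (u(l := y)) \<partial>\<nu>) \<partial>PiM J (\<lambda>_. \<nu>))"
      unfolding J(3) by (rule P.product_integral_insert[OF J(1,2)])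
    also have "\<dots> = (\<integral>u. Z k u * (\<integral>y. h (u j, y) - (\<integral>w. h (u j, w) \<partial>\<nu>) \<partial>\<nu>) \<partial>PiM J (\<lambda>_. \<nu>))"
      using kl by (simp add: Z_def)
    also have "\<dots> = 0"
      using integrable_h[OF \<nu>] \<nu>.prob_space by simp
    finally show ?thesis .
  qed
  show ?thesis
  proof (cases "l = j")
    case True
    then show ?thesis using *[of l k] assms by (simp add: mult.commute)
  next
    case False
    then show ?thesis using *[of k l] assms by simp
  qed
qed

text \<open>A weak law of large numbers: in the second moment of the mean of the \<open>Z k\<close>
  only the \<open>N\<close> diagonal terms survive, each at most \<open>L2\<^sup>2\<close>, against
  a factor \<open>N\<^sup>2\<close>. The self-interaction \<open>k = j\<close> need not be centred;
  its products with the other terms still vanish by \<open>deviations_uncorrelated\<close>, and its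
  square obeys the same bound.\<close>

lemma drift_deviation_le:
  assumes \<nu>: "\<nu> \<in> space (prob_algebra borel)" and j: "j \<in> {1..N}"
  shows "(\<integral>u. \<bar>drift f h N j u - mean_drift f h \<nu> (u j)\<bar> \<partial>power_measure \<nu> N) \<le> (L2\<^sup>2 + 1) / (2 * sqrt (real N))"
    and "\<bar>drift f h N j u - mean_drift f h \<nu> (u j)\<bar> \<le> L2"
proof -
  interpret \<nu>: prob_space \<nu> using \<nu> by (simp add: space_prob_algebra)
  interpret P: product_prob_space "\<lambda>_. \<nu>" "{1..N}" ..
  have s: "sets \<nu> = sets borel" using \<nu> by (simp add: space_prob_algebra)
  note [measurable_cong] = s
  note [measurable] = mean_h_measurable[OF \<nu>]
  define Z where "Z = (\<lambda>k u. h (u j, u k) - (\<integral>w. h (u j, w) \<partial>\<nu>))"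
  define r where "r = sqrt (real N)"
  have N: "0 < real N" "0 < r" "r * r = real N" using j by (auto simp: r_def)
  have Zm: "Z k \<in> borel_measurable (power_measure \<nu> N)" if "k \<in> {1..N}" for k
  proof -
    have [measurable]: "(\<lambda>u. u i) \<in> borel_measurable (power_measure \<nu> N)" if "i \<in> {1..N}" for i
      using measurable_component_singleton[OF that, of "\<lambda>_. \<nu>"] by (simp add: measurable_cong_sets[OF refl s])
    show ?thesis unfolding Z_def using that j by measurable
  qed
  have ZB: "\<bar>Z k u\<bar> \<le> L2" for k u unfolding Z_def by (rule h_deviation_le[OF \<nu>])
  define X where "X = (\<lambda>u. (\<Sum>k=1..N. Z k u) / real N)"
  have X: "drift f h N j u - mean_drift f h \<nu> (u j) = X u" for u
    using N by (simp add: X_def Z_def drift_def mean_drift_def sum_subtractf field_simps)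
  have XB: "\<bar>X u\<bar> \<le> L2" for u
  proof -
    have "\<bar>\<Sum>k=1..N. Z k u\<bar> \<le> (\<Sum>k=1..N. L2)"
      by (rule order_trans[OF sum_abs sum_mono]) (rule ZB)
    then show ?thesis using N by (simp add: X_def field_simps)
  qed
  then show "\<bar>drift f h N j u - mean_drift f h \<nu> (u j)\<bar> \<le> L2" by (simp add: X)
  have Xm: "X \<in> borel_measurable (power_measure \<nu> N)"
    unfolding X_def using Zm by (intro borel_measurable_divide borel_measurable_sum) auto
  have Zi: "integrable (power_measure \<nu> N) (\<lambda>u. Z k u * Z l u)" if "k \<in> {1..N}" "l \<in> {1..N}" for k l
  proof (rule P.integrable_bounded)
    show "\<bar>Z k u * Z l u\<bar> \<le> L2 * L2" for u
      unfolding abs_mult by (intro mult_mono ZB) (auto simp: nonneg)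
  qed (use Zm that in auto)
  have "(\<integral>u. (X u)\<^sup>2 \<partial>power_measure \<nu> N)
      = (\<integral>u. (\<Sum>k=1..N. \<Sum>l=1..N. Z k u * Z l u) / (real N)\<^sup>2 \<partial>power_measure \<nu> N)"
    by (simp add: X_def power_divide power2_eq_square sum_product)
  also have "\<dots> = (\<Sum>k=1..N. \<Sum>l=1..N. \<integral>u. Z k u * Z l u \<partial>power_measure \<nu> N) / (real N)\<^sup>2"
    using Zi by (subst integral_divide_zero, subst Bochner_Integration.integral_sum)
      (auto intro!: Bochner_Integration.integrable_sum sum.cong)
  also have "\<dots> \<le> (\<Sum>k=1..N. \<Sum>l=1..N. if l = k then L2\<^sup>2 else 0) / (real N)\<^sup>2"
  proof (intro divide_right_mono sum_mono)
    fix k l assume kl: "k \<in> {1..N}" "l \<in> {1..N}"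
    show "(\<integral>u. Z k u * Z l u \<partial>power_measure \<nu> N) \<le> (if l = k then L2\<^sup>2 else 0)"
    proof (cases "l = k")
      case True
      have "\<bar>\<integral>u. Z k u * Z k u \<partial>power_measure \<nu> N\<bar> \<le> L2 * L2"
      proof (rule P.abs_integral_le_bound)
        show "\<bar>Z k u * Z k u\<bar> \<le> L2 * L2" for u
          unfolding abs_mult by (intro mult_mono ZB) (auto simp: nonneg)
      qed (use Zm kl in auto)
      then show ?thesis using True by (simp add: power2_eq_square)
    next
      case False
      then show ?thesis
        using deviations_uncorrelated[OF \<nu> _ j kl] by (simp add: Z_def)
    qed
  qed simp
  also have "\<dots> = L2\<^sup>2 / real N"
    using N by (simp add: power2_eq_square)
  finally have X2: "(\<integral>u. (X u)\<^sup>2 \<partial>power_measure \<nu> N) \<le> L2\<^sup>2 / real N" .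
  have Xi: "integrable (power_measure \<nu> N) X"
    by (rule P.integrable_bounded[OF Xm XB])
  have X2i: "integrable (power_measure \<nu> N) (\<lambda>u. (X u)\<^sup>2)"
  proof (rule P.integrable_bounded)
    show "\<bar>(X u)\<^sup>2\<bar> \<le> L2\<^sup>2" for u
      using XB[of u] nonneg by (simp add: abs_le_square_iff[symmetric])
  qed (use Xm in auto)
  have P1: "measure (power_measure \<nu> N) (space (power_measure \<nu> N)) = 1"
    by (intro prob_space.prob_space prob_space_PiM \<nu>.prob_space_axioms)
  have const: "integrable (power_measure \<nu> N) (\<lambda>u. 1 / r)"
    by (rule P.integrable_const)
  \<comment> \<open>A weighted arithmetic-geometric mean inequality passes from the second moment to
    the first. The weight \<open>r = sqrt N\<close> balances the two terms, both of order
    \<open>1 / r\<close>, and produces the constant \<open>(L2\<^sup>2 + 1) / 2\<close>.\<close>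
  have amgm: "\<bar>X u\<bar> \<le> (r * (X u)\<^sup>2 + 1 / r) / 2" for u
  proof -
    have "0 \<le> (r * \<bar>X u\<bar> - 1)\<^sup>2 / r" using N by simp
    also have "\<dots> = r * (X u)\<^sup>2 + 1 / r - 2 * \<bar>X u\<bar>"
      using N by (simp add: power2_eq_square field_simps)
    finally show ?thesis by simp
  qed
  have "(\<integral>u. \<bar>X u\<bar> \<partial>power_measure \<nu> N) \<le> (\<integral>u. (r * (X u)\<^sup>2 + 1 / r) / 2 \<partial>power_measure \<nu> N)"
    using Xi amgm
    by (intro integral_mono integrable_divide_zero Bochner_Integration.integrable_add integrable_mult_right
        integrable_abs X2i P.integrable_const)
  also have "\<dots> = (r * (\<integral>u. (X u)\<^sup>2 \<partial>power_measure \<nu> N) + 1 / r) / 2"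
    using X2i P1 const by simp
  also have "\<dots> \<le> (r * (L2\<^sup>2 / real N) + 1 / r) / 2"
    using X2 N by (intro divide_right_mono add_right_mono mult_left_mono) auto
  also have "\<dots> = (L2\<^sup>2 + 1) / (2 * r)"
    unfolding N(3)[symmetric] using N(2) by (simp add: field_simps)
  finally show "(\<integral>u. \<bar>drift f h N j u - mean_drift f h \<nu> (u j)\<bar> \<partial>power_measure \<nu> N) \<le> (L2\<^sup>2 + 1) / (2 * sqrt (real N))"
    by (simp add: X r_def)
qed

text \<open>Triangle inequality through \<open>mix p N (drift f h N)\<close> of the power of \<nu>.
  The first difference tests \<mu> against that power with the function of
  \<open>coord_lipschitz_kernel\<close>, whose constants sum to \<open>(Lf + L1 + L2)\<close> times
  the sum of \<open>E\<close>. The second keeps the measure and changes the drift, at a cost of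
  order \<open>1 / sqrt N\<close> per coordinate.\<close>

lemma one_step:
  assumes \<mu>: "\<mu> \<in> space (prob_algebra (torus N))" and \<nu>: "\<nu> \<in> space (prob_algebra borel)"
    and N: "1 \<le> N" and g: "noise_lipschitz p N E g"
  shows "(\<integral>x. g x \<partial>transfer_N f h p N \<mu>) - (\<integral>x. g x \<partial>power_measure (transfer_self_consistent f h p \<nu>) N)
    \<le> (\<Sum>j=1..N. E j) * ((Lf + L1 + L2) * W1 N \<mu> (power_measure \<nu> N) + (L2\<^sup>2 + 1) / (2 * sqrt (real N)))"
proof -
  let ?S = "\<Sum>j=1..N. E j" and ?P = "power_measure \<nu> N"
  let ?Q = "\<lambda>u. \<integral>x. g x \<partial>PiM {1..N} (\<lambda>j. noise p (drift f h N j u))"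
  note P = power_measure_prob[OF \<nu>, of N]
  have s: "sets \<mu> = sets (torus N)" "sets ?P = sets (torus N)" and pr: "prob_space \<mu>" "prob_space ?P"
    using \<mu> P by (auto simp: space_prob_algebra)
  have E: "0 \<le> E j" if "j \<in> {1..N}" for j using g that by (simp add: noise_lipschitz_def)
  obtain B where B: "\<And>x. x \<in> space (torus N) \<Longrightarrow> \<bar>g x\<bar> \<le> B"
    using g unfolding noise_lipschitz_def by blast
  have gm: "g \<in> borel_measurable (torus N)" using g by (simp add: noise_lipschitz_def)
  have dm: "drift f h N j \<in> borel_measurable M" if "j \<in> {1..N}" "sets M = sets (torus N)" for j M
    using drift_measurable[OF that(1)] by (simp only: measurable_cong_sets[OF that(2) refl])
  have mm: "(\<lambda>u. mean_drift f h \<nu> (u j)) \<in> borel_measurable ?P" if "j \<in> {1..N}" for j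
    unfolding measurable_cong_sets[OF s(2) refl]
    using measurable_compose[OF measurable_component_singleton[OF that] mean_drift_measurable[OF \<nu>]] .
  have "(\<integral>x. g x \<partial>transfer_N f h p N \<mu>) - (\<integral>x. g x \<partial>mix p N (drift f h N) ?P) = (\<integral>u. ?Q u \<partial>\<mu>) - (\<integral>u. ?Q u \<partial>?P)"
    unfolding transfer_N_eq_mix
    using integral_mix(1)[where F="drift f h N" and \<mu>=\<mu>, OF p pr(1) dm gm B] s
      integral_mix(1)[where F="drift f h N" and \<mu>="?P", OF p pr(2) dm gm B] by simp
  also have "\<dots> \<le> (\<Sum>i=1..N. (Lf + L1) * E i + L2 / real N * ?S) * W1 N \<mu> ?P"
    by (rule integral_diff_le_W1[OF coord_lipschitz_kernel[OF g] \<mu> P])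
  also have "(\<Sum>i=1..N. (Lf + L1) * E i + L2 / real N * ?S) = (Lf + L1 + L2) * ?S"
    using N by (simp add: sum.distrib algebra_simps flip: sum_distrib_left)
  finally have 1: "(\<integral>x. g x \<partial>transfer_N f h p N \<mu>) - (\<integral>x. g x \<partial>mix p N (drift f h N) ?P)
      \<le> (Lf + L1 + L2) * ?S * W1 N \<mu> ?P" .
  have "(\<integral>x. g x \<partial>mix p N (drift f h N) ?P) - (\<integral>x. g x \<partial>power_measure (transfer_self_consistent f h p \<nu>) N)
      \<le> (\<Sum>j=1..N. E j * (\<integral>u. \<bar>drift f h N j u - mean_drift f h \<nu> (u j)\<bar> \<partial>?P))"
    unfolding power_measure_transfer_eq_mix[OF \<nu>]
    by (rule integral_mix_diff_le[where D=L2, OF p pr(2) dm[OF _ s(2)] mm drift_deviation_le(2)[OF \<nu>] g])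
  also have "\<dots> \<le> (\<Sum>j=1..N. E j * ((L2\<^sup>2 + 1) / (2 * sqrt (real N))))"
    using E by (intro sum_mono mult_left_mono drift_deviation_le(1) \<nu>)
  also have "\<dots> = ?S * ((L2\<^sup>2 + 1) / (2 * sqrt (real N)))"
    by (rule sum_distrib_right[symmetric])
  finally show ?thesis using 1 by (simp only: distrib_left) (simp add: mult_ac)
qed

end

section \<open>Lipschitz constants, marginals and total variation\<close>

lemma ex_circle_neq: "\<exists>u v :: circle. u \<noteq> v"
proof -
  have "to_circle 0 \<noteq> to_circle (1 / 2)"
    by (auto simp: to_circle_eq_iff elim!: Ints_cases)
  then show ?thesis by blast
qed

text \<open>The Lipschitz hypothesis bounds the difference quotients, which makes the real-valued
  supremum an upper bound for them. Nonnegativity comes from one actual quotient, for which two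
  distinct points of the circle are required.\<close>

lemma Lip_bound:
  assumes "L-lipschitz_on UNIV f"
  shows "\<bar>f u - f u'\<bar> \<le> Lip f * dist u u'" and "0 \<le> Lip f"
proof -
  let ?D = "{(u::circle, u'). u \<noteq> u'}"
  have bdd: "bdd_above ((\<lambda>(u, u'). \<bar>f u - f u'\<bar> / dist u u') ` ?D)"
  proof (rule bdd_aboveI2[of _ _ L])
    fix x assume "x \<in> ?D"
    then show "(case x of (u, u') \<Rightarrow> \<bar>f u - f u'\<bar> / dist u u') \<le> L"
      using lipschitz_onD[OF assms] by (auto simp: dist_real_def divide_le_eq)
  qed
  have quot: "\<bar>f u - f u'\<bar> / dist u u' \<le> Lip f" if "u \<noteq> u'" for u u'
    unfolding Lip_def using cSUP_upper[OF _ bdd, of "(u, u')"] that by simp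
  then show "\<bar>f u - f u'\<bar> \<le> Lip f * dist u u'"
    by (cases "u = u'") (auto simp: divide_le_eq)
  obtain u v :: circle where "u \<noteq> v" using ex_circle_neq by blast
  from quot[OF this] show "0 \<le> Lip f"
    by (rule order_trans[rotated]) simp
qed

text \<open>For pairs sharing one entry the product metric reduces to the distance of the other
  entries, so the joint Lipschitz constant also bounds the partial quotients.\<close>

lemma Lip1_bound:
  assumes "L-lipschitz_on UNIV h"
  shows "\<bar>h (u, v) - h (u', v)\<bar> \<le> Lip1 h * dist u u'" and "0 \<le> Lip1 h"
proof -
  let ?D = "{(u::circle, u', v::circle). u \<noteq> u'}"
  have bdd: "bdd_above ((\<lambda>(u, u', v). \<bar>h (u, v) - h (u', v)\<bar> / dist u u') ` ?D)"
  proof (rule bdd_aboveI2[of _ _ L])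
    fix x assume "x \<in> ?D"
    then obtain u u' v where x: "x = (u, u', v)" "u \<noteq> u'" by auto
    show "(case x of (u, u', v) \<Rightarrow> \<bar>h (u, v) - h (u', v)\<bar> / dist u u') \<le> L"
      using lipschitz_onD[OF assms, of "(u, v)" "(u', v)"] x by (simp add: dist_real_def dist_Pair_Pair divide_le_eq)
  qed
  have quot: "\<bar>h (u, v) - h (u', v)\<bar> / dist u u' \<le> Lip1 h" if "u \<noteq> u'" for u u' v
    unfolding Lip1_def using cSUP_upper[OF _ bdd, of "(u, u', v)"] that by simp
  then show "\<bar>h (u, v) - h (u', v)\<bar> \<le> Lip1 h * dist u u'"
    by (cases "u = u'") (auto simp: divide_le_eq)
  obtain u v :: circle where "u \<noteq> v" using ex_circle_neq by blast
  from quot[OF this] show "0 \<le> Lip1 h"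
    by (rule order_trans[rotated]) simp
qed

lemma Lip2_bound:
  assumes "L-lipschitz_on UNIV h"
  shows "\<bar>h (v, u) - h (v, u')\<bar> \<le> Lip2 h * dist u u'" and "0 \<le> Lip2 h"
proof -
  let ?D = "{(v::circle, u::circle, u'). u \<noteq> u'}"
  have bdd: "bdd_above ((\<lambda>(v, u, u'). \<bar>h (v, u) - h (v, u')\<bar> / dist u u') ` ?D)"
  proof (rule bdd_aboveI2[of _ _ L])
    fix x assume "x \<in> ?D"
    then obtain u u' v where x: "x = (v, u, u')" "u \<noteq> u'" by auto
    show "(case x of (v, u, u') \<Rightarrow> \<bar>h (v, u) - h (v, u')\<bar> / dist u u') \<le> L"
      using lipschitz_onD[OF assms, of "(v, u)" "(v, u')"] x by (simp add: dist_real_def dist_Pair_Pair divide_le_eq)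
  qed
  have quot: "\<bar>h (v, u) - h (v, u')\<bar> / dist u u' \<le> Lip2 h" if "u \<noteq> u'" for u u' v
    unfolding Lip2_def using cSUP_upper[OF _ bdd, of "(v, u, u')"] that by simp
  then show "\<bar>h (v, u) - h (v, u')\<bar> \<le> Lip2 h * dist u u'"
    by (cases "u = u'") (auto simp: divide_le_eq)
  obtain u v :: circle where "u \<noteq> v" using ex_circle_neq by blast
  from quot[OF this] show "0 \<le> Lip2 h"
    by (rule order_trans[rotated]) simp
qed

text \<open>The bound on one period extends by periodicity through \<open>frac x\<close>.
  Integrating it over \<open>{0..1}\<close> compares \<open>c\<close> with the total mass 1, so the
  factor \<open>1 - c\<close> is nonnegative.\<close>

lemma periodic_density_lower_bound:
  assumes p: "periodic_density p" and lower: "\<forall>x\<in>{0..1}. c < p x" and "0 \<le> c"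
  shows "c \<le> p x" and "c \<le> 1"
proof -
  have "p (frac x) = p x" using p_frac[OF p, of x 0] by simp
  moreover have "frac x \<in> {0..1}" using frac_lt_1[of x] by (simp add: less_imp_le)
  ultimately show "c \<le> p x" using lower by (metis less_imp_le)
  have "ennreal c = (\<integral>\<^sup>+x\<in>{0..1::real}. ennreal c \<partial>lborel)"
    by (simp add: nn_integral_cmult_indicator)
  also have "\<dots> \<le> (\<integral>\<^sup>+x\<in>{0..1}. ennreal (p x) \<partial>lborel)"
    using lower by (intro nn_integral_mono) (auto simp: less_imp_le ennreal_leI split: split_indicator)
  also have "\<dots> = ennreal 1"
    using p unfolding periodic_density_def ennreal_1 by blast
  finally show "c \<le> 1" by (rule ennreal_le_iff[THEN iffD1, OF zero_le_one])
qed

lemma marginal_power_measure: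
  assumes \<nu>: "\<nu> \<in> space (prob_algebra borel)" and "k \<le> N"
  shows "marginal k (power_measure \<nu> N) = power_measure \<nu> k"
proof -
  interpret \<nu>: prob_space \<nu> using \<nu> by (simp add: space_prob_algebra)
  interpret P: product_prob_space "\<lambda>_. \<nu>" "{1..N}" ..
  have s: "sets \<nu> = sets borel" using \<nu> by (simp add: space_prob_algebra)
  have "marginal k (power_measure \<nu> N) = distr (power_measure \<nu> N) (power_measure \<nu> k) (\<lambda>x. restrict x {1..k})"
    unfolding marginal_def by (intro distr_cong sets_PiM_cong) (auto simp: s)
  also have "\<dots> = power_measure \<nu> k"
    using assms by (intro P.distr_restrict[symmetric]) auto
  finally show ?thesis .
qed

lemma first_marginal_prob:
  assumes "\<mu> \<in> space (prob_algebra (torus N))" "1 \<le> N"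
  shows "first_marginal \<mu> \<in> space (prob_algebra borel)"
proof -
  have s: "sets \<mu> = sets (torus N)" and "prob_space \<mu>"
    using assms by (auto simp: space_prob_algebra)
  moreover have "(\<lambda>x. x 1) \<in> borel_measurable \<mu>"
    unfolding measurable_cong_sets[OF s refl] using assms(2) by (intro measurable_component_singleton) auto
  ultimately show ?thesis
    by (auto simp: first_marginal_def space_prob_algebra intro: prob_space.prob_space_distr)
qed

text \<open>Weighting each cell of a partition by the sign of the difference of the measures
  turns the sum of absolute differences into a difference of integrals.\<close>

lemma tv_norm_diff_marginal_le:
  assumes \<mu>: "\<mu>1 \<in> space (prob_algebra (torus N))" "\<mu>2 \<in> space (prob_algebra (torus N))" and k: "k \<le> N"
    and w: "\<And>g :: (nat \<Rightarrow> circle) \<Rightarrow> real. g \<in> borel_measurable (torus N) \<Longrightarrow> (\<And>x. \<bar>g x\<bar> \<le> 1) \<Longrightarrow>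
      (\<And>x y j. k < j \<Longrightarrow> g (x(j := y)) = g x) \<Longrightarrow> (\<integral>x. g x \<partial>\<mu>1) - (\<integral>x. g x \<partial>\<mu>2) \<le> w"
  shows "tv_norm_diff (marginal k \<mu>1) (marginal k \<mu>2) \<le> w"
  unfolding tv_norm_diff_def
proof (rule cSUP_least)
  \<comment> \<open>The cells of a partition are non-empty, so the partition into a single cell
    exists only because the torus is non-empty.\<close>
  have ne: "space (torus k) \<noteq> {}" by (simp add: space_torus PiE_eq_empty_iff)
  then have "{space (torus k)} \<in> {P. finite P \<and> P \<subseteq> sets (marginal k \<mu>1) \<and> partition_on (space (marginal k \<mu>1)) P}"
    using ne ne[symmetric] by (auto simp: marginal_def partition_on_def)
  then show "{P. finite P \<and> P \<subseteq> sets (marginal k \<mu>1) \<and> partition_on (space (marginal k \<mu>1)) P} \<noteq> {}"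
    by blast
next
  fix P assume "P \<in> {P. finite P \<and> P \<subseteq> sets (marginal k \<mu>1) \<and> partition_on (space (marginal k \<mu>1)) P}"
  then have P: "finite P" "P \<subseteq> sets (torus k)" "partition_on (space (torus k)) P"
    by (auto simp: marginal_def)
  define r :: "(nat \<Rightarrow> circle) \<Rightarrow> _" where "r = (\<lambda>x. restrict x {1..k})"
  define s where "s = (\<lambda>A. sgn (measure (marginal k \<mu>1) A - measure (marginal k \<mu>2) A))"
  define g where "g = (\<lambda>x. \<Sum>A\<in>P. s A * indicator A (r x))"
  have rm: "r \<in> measurable (torus N) (torus k)"
    unfolding r_def using k by (intro measurable_restrict_subset) auto
  have rA: "(\<lambda>x. indicator A (r x) :: real) \<in> borel_measurable (torus N)" if "A \<in> P" for A
    using that P by (intro measurable_compose[OF rm] borel_measurable_indicator) auto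
  have gm: "g \<in> borel_measurable (torus N)"
    unfolding g_def using rA by (intro borel_measurable_sum borel_measurable_times) auto
  \<comment> \<open>The cells are disjoint, so at most one summand is nonzero, and it is a
    sign.\<close>
  have gB: "\<bar>g x\<bar> \<le> 1" for x
  proof (cases "\<exists>A0\<in>P. r x \<in> A0")
    case True
    then obtain A0 where A0: "A0 \<in> P" "r x \<in> A0" by blast
    have "g x = (\<Sum>A\<in>P. if A = A0 then s A0 else 0)"
      unfolding g_def
    proof (rule sum.cong[OF refl])
      fix A assume "A \<in> P"
      then have "A = A0 \<or> r x \<notin> A"
        using A0 partition_onD2[OF P(3)] by (auto simp: disjoint_def)
      then show "s A * indicator A (r x) = (if A = A0 then s A0 else 0)" using A0 by auto
    qed
    then show ?thesis using A0 P(1) by (simp add: s_def abs_sgn_eq)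
  next
    case False
    then have "g x = 0" unfolding g_def by (intro sum.neutral) auto
    then show ?thesis by simp
  qed
  have gdep: "g (x(j := y)) = g x" if "k < j" for x y j
    using that by (simp add: g_def r_def restrict_upd)
  have int: "(\<integral>x. g x \<partial>\<mu>) = (\<Sum>A\<in>P. s A * measure (marginal k \<mu>) A)"
    if \<mu>: "\<mu> \<in> space (prob_algebra (torus N))" for \<mu>
  proof -
    have sets: "sets \<mu> = sets (torus N)" using \<mu> by (simp add: space_prob_algebra)
    interpret prob_space \<mu> using \<mu> by (simp add: space_prob_algebra)
    have rm': "r \<in> measurable \<mu> (torus k)" and rA': "\<And>A. A \<in> P \<Longrightarrow> (\<lambda>x. indicator A (r x) :: real) \<in> borel_measurable \<mu>"
      unfolding measurable_cong_sets[OF sets refl] by (rule rm rA)+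
    have m: "measure (marginal k \<mu>) A = (\<integral>x. indicator A (r x) \<partial>\<mu>)" if "A \<in> P" for A
    proof -
      have A: "A \<in> sets (torus k)" using that P by auto
      have "measure (marginal k \<mu>) A = (\<integral>y. indicator A y \<partial>marginal k \<mu>)"
        using sets.sets_into_space[OF A] by (simp add: marginal_def Int_absorb2)
      also have "\<dots> = (\<integral>x. indicator A (r x) \<partial>\<mu>)"
        unfolding marginal_def r_def[symmetric] using rm' A by (intro integral_distr) auto
      finally show ?thesis .
    qed
    have "integrable \<mu> (\<lambda>x. s A * indicator A (r x))" if "A \<in> P" for A
      using rA'[OF that] by (intro integrable_mult_right integrable_bounded[where B=1]) (auto simp: indicator_def)
    then show ?thesis
      unfolding g_def by (subst Bochner_Integration.integral_sum) (auto simp: m)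
  qed
  have "(\<Sum>A\<in>P. \<bar>measure (marginal k \<mu>1) A - measure (marginal k \<mu>2) A\<bar>) = (\<integral>x. g x \<partial>\<mu>1) - (\<integral>x. g x \<partial>\<mu>2)"
    unfolding int[OF \<mu>(1)] int[OF \<mu>(2)] sum_subtractf[symmetric]
    by (intro sum.cong) (auto simp: s_def abs_sgn algebra_simps)
  also have "\<dots> \<le> w" by (rule w[OF gm gB gdep])
  finally show "(\<Sum>A\<in>P. \<bar>measure (marginal k \<mu>1) A - measure (marginal k \<mu>2) A\<bar>) \<le> w" .
qed

text \<open>\<open>b / (1 - q)\<close> is the fixed point of \<open>t \<mapsto> q * t + b\<close>,
  so it reproduces itself in the induction step.\<close>

lemma geometric_recursion_le:
  fixes a :: "nat \<Rightarrow> real"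
  assumes "\<And>n. a (Suc n) \<le> q * a n + b" "0 \<le> q" "q < 1" "0 \<le> b"
  shows "a n \<le> q ^ n * a 0 + b / (1 - q)"
proof (induct n)
  case 0
  then show ?case using assms by simp
next
  case (Suc n)
  have "a (Suc n) \<le> q * (q ^ n * a 0 + b / (1 - q)) + b"
    using assms(1)[of n] mult_left_mono[OF Suc assms(2)] by linarith
  also have "\<dots> = q ^ Suc n * a 0 + b / (1 - q)"
    using assms(3) by (simp add: field_simps)
  finally show ?case .
qed

section \<open>Iteration of the one-step bounds and conclusion\<close>

context mean_field
begin

lemma iterate_probs:
  assumes "\<mu> \<in> space (prob_algebra (torus N))" and "\<nu> \<in> space (prob_algebra borel)"
  shows "(transfer_N f h p N ^^ n) \<mu> \<in> space (prob_algebra (torus N))"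
    and "(transfer_self_consistent f h p ^^ n) \<nu> \<in> space (prob_algebra borel)"
  by (induct n) (use assms transfer_N_prob transfer_self_consistent_prob in auto)

text \<open>The reference measure moves with the system: at each time the law is compared with the
  power of the current iterate of \<nu>. So \<open>one_step\<close> applies anew with the same
  constants, and no independence of the evolved particles is required.\<close>

lemma W1_iterates_le:
  assumes c: "\<And>x. c \<le> p x" "0 \<le> c" "c \<le> 1"
    and \<kappa>: "(1 - c) * (Lf + L1 + L2) < 1"
    and \<mu>: "\<mu> \<in> space (prob_algebra (torus N))" and \<nu>: "\<nu> \<in> space (prob_algebra borel)" and N: "1 \<le> N"
  shows "W1 N ((transfer_N f h p N ^^ n) \<mu>) (power_measure ((transfer_self_consistent f h p ^^ n) \<nu>) N)
    \<le> ((1 - c) * (Lf + L1 + L2)) ^ n * W1 N \<mu> (power_measure \<nu> N)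
      + (L2\<^sup>2 + 1) / (2 * sqrt (real N)) / (1 - (1 - c) * (Lf + L1 + L2))"
proof -
  define D where "D = (L2\<^sup>2 + 1) / (2 * sqrt (real N))"
  have D: "0 \<le> D" by (simp add: D_def)
  define \<kappa> where "\<kappa> = (1 - c) * (Lf + L1 + L2)"
  have \<kappa>0: "0 \<le> \<kappa>" using c nonneg by (simp add: \<kappa>_def)
  define a where "a = (\<lambda>n. W1 N ((transfer_N f h p N ^^ n) \<mu>) (power_measure ((transfer_self_consistent f h p ^^ n) \<nu>) N))"
  have "a (Suc n) \<le> \<kappa> * a n + D" for n
  proof -
    let ?\<mu> = "(transfer_N f h p N ^^ n) \<mu>" and ?\<nu> = "(transfer_self_consistent f h p ^^ n) \<nu>"
    note it = iterate_probs[OF \<mu> \<nu>, of n]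
    have a0: "0 \<le> a n" unfolding a_def by (intro W1_nonneg it power_measure_prob)
    have "W1 N (transfer_N f h p N ?\<mu>) (power_measure (transfer_self_consistent f h p ?\<nu>) N) \<le> \<kappa> * a n + D"
    proof (rule W1_leI)
      fix g L assume L: "coord_lipschitz N L g" "(\<Sum>i=1..N. L i) \<le> 1"
      have "0 \<le> (\<Sum>i=1..N. L i)" using L by (auto simp: coord_lipschitz_def intro!: sum_nonneg)
      then have S: "0 \<le> (\<Sum>i=1..N. (1 - c) * L i)" "(\<Sum>i=1..N. (1 - c) * L i) \<le> 1 - c"
        using c L(2) mult_left_mono[of "\<Sum>i=1..N. L i" 1 "1 - c"] unfolding sum_distrib_left[symmetric] by auto
      have "(\<integral>x. g x \<partial>transfer_N f h p N ?\<mu>) - (\<integral>x. g x \<partial>power_measure (transfer_self_consistent f h p ?\<nu>) N)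
          \<le> (\<Sum>i=1..N. (1 - c) * L i) * ((Lf + L1 + L2) * a n + D)"
        unfolding a_def D_def by (intro one_step it N noise_lipschitz_of_coord_lipschitz p L c)
      also have "\<dots> \<le> (1 - c) * ((Lf + L1 + L2) * a n + D)"
        using S a0 D nonneg by (intro mult_right_mono) auto
      also have "\<dots> = \<kappa> * a n + (1 - c) * D" by (simp add: \<kappa>_def algebra_simps)
      \<comment> \<open>The factor \<open>1 - c\<close> in front of the error is dropped, as it is
        at most 1; the one in front of the distance has been absorbed in \<kappa>.\<close>
      also have "\<dots> \<le> \<kappa> * a n + D" using D c by (simp add: mult_left_le_one_le)
      finally show "(\<integral>x. g x \<partial>transfer_N f h p N ?\<mu>) - (\<integral>x. g x \<partial>power_measure (transfer_self_consistent f h p ?\<nu>) N)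
          \<le> \<kappa> * a n + D" .
    qed
    then show ?thesis by (simp add: a_def)
  qed
  from geometric_recursion_le[where a=a and q=\<kappa> and b=D, OF this \<kappa>0 _ D, of n] \<kappa>
  show ?thesis by (simp add: a_def \<kappa>_def D_def)
qed

text \<open>One application of the noise turns a bounded test function into a Lipschitz one, at a
  price of \<open>4 * V + 2\<close> for each of the \<open>k\<close> coordinates it sees. This is
  how a bound in \<open>W1\<close> at one time yields total variation at the next.\<close>

lemma tv_one_step:
  assumes V: "\<And>(n::nat) (t::nat \<Rightarrow> real). mono_on {..n} t \<Longrightarrow> t ` {..n} \<subseteq> {0..1} \<Longrightarrow>
      (\<Sum>i<n. \<bar>p (t (Suc i)) - p (t i)\<bar>) \<le> V"
    and \<mu>: "\<mu> \<in> space (prob_algebra (torus N))" and \<nu>: "\<nu> \<in> space (prob_algebra borel)"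
    and N: "1 \<le> N" "k \<le> N"
  shows "tv_norm_diff (marginal k (transfer_N f h p N \<mu>)) (power_measure (transfer_self_consistent f h p \<nu>) k)
    \<le> real k * (4 * V + 2) * ((Lf + L1 + L2) * W1 N \<mu> (power_measure \<nu> N) + (L2\<^sup>2 + 1) / (2 * sqrt (real N)))"
proof -
  note \<nu>' = transfer_self_consistent_prob[OF \<nu>]
  have "(\<Sum>j=1..N. if j \<le> k then 4 * V + 2 else 0) = (\<Sum>j=1..k. 4 * V + 2)"
    using N by (intro sum.mono_neutral_cong_right) auto
  then have S: "(\<Sum>j=1..N. if j \<le> k then 4 * V + 2 else 0) = real k * (4 * V + 2)" by simp
  have "tv_norm_diff (marginal k (transfer_N f h p N \<mu>)) (marginal k (power_measure (transfer_self_consistent f h p \<nu>) N))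
    \<le> real k * (4 * V + 2) * ((Lf + L1 + L2) * W1 N \<mu> (power_measure \<nu> N) + (L2\<^sup>2 + 1) / (2 * sqrt (real N)))"
    unfolding S[symmetric]
    by (rule tv_norm_diff_marginal_le[OF transfer_N_prob[OF \<mu>] power_measure_prob[OF \<nu>'] N(2)],
        rule one_step[OF \<mu> \<nu> N(1)], rule noise_lipschitz_of_bounded_variation[OF p V])
  then show ?thesis unfolding marginal_power_measure[OF \<nu>' N(2)] .
qed

end

theorem theorem1p5:
  fixes f :: "circle \<Rightarrow> real"
    and h :: "circle \<times> circle \<Rightarrow> real"
    and p :: "real \<Rightarrow> real"
    and c \<kappa> :: real
  assumes f_Lipschitz: "\<exists>L. L-lipschitz_on UNIV f"
    and h_Lipschitz: "\<exists>L. L-lipschitz_on UNIV h"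
    and p_density: "periodic_density p"
    and c_pos: "c > 0"
    and p_lower: "\<forall>x\<in>{0..1}. p x > c"
    and kappa: "\<kappa> = (1 - c) * (Lip f + Lip1 h + Lip2 h)"
    and kappa_less: "\<kappa> < sqrt 3 / 2"
  shows "(\<exists>C0 > 0. \<forall>N \<ge> 2. \<forall>\<mu> \<in> space (prob_algebra (torus N)). exchangeable N \<mu> \<longrightarrow>
      (\<forall>n. W1 N ((transfer_N f h p N ^^ n) \<mu>)
              (power_measure ((transfer_self_consistent f h p ^^ n) (first_marginal \<mu>)) N)
            \<le> \<kappa> ^ n * W1 N \<mu> (power_measure (first_marginal \<mu>) N) + C0 * real N powr (- 1 / 2)))
    \<and> (bv_circle p \<longrightarrow>
      (\<forall>k \<ge> 1. \<exists>C0 > 0. \<exists>C1 > 0. \<forall>N \<ge> 2. N \<ge> k \<longrightarrow>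
        (\<forall>\<mu> \<in> space (prob_algebra (torus N)). exchangeable N \<mu> \<longrightarrow>
          (\<forall>n \<ge> 1. tv_norm_diff
                (marginal k ((transfer_N f h p N ^^ n) \<mu>))
                (power_measure ((transfer_self_consistent f h p ^^ n) (first_marginal \<mu>)) k)
              \<le> C0 * \<kappa> ^ (n - 1) * W1 N \<mu> (power_measure (first_marginal \<mu>) N)
                + C1 * real N powr (- 1 / 2)))))"
proof -
  obtain Kf Kh where K: "Kf-lipschitz_on UNIV f" "Kh-lipschitz_on UNIV h"
    using f_Lipschitz h_Lipschitz by blast
  have fm: "f \<in> borel_measurable borel" "h \<in> borel_measurable (borel \<Otimes>\<^sub>M borel)"
    unfolding borel_prod
    using K[THEN lipschitz_on_continuous_on] by (auto intro: borel_measurable_continuous_onI)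
  interpret mean_field f h p "Lip f" "Lip1 h" "Lip2 h"
    using p_density fm Lip_bound[OF K(1)] Lip1_bound[OF K(2)] Lip2_bound[OF K(2)]
    by unfold_locales auto
  have c: "\<And>x. c \<le> p x" "0 \<le> c" "c \<le> 1"
    using periodic_density_lower_bound[OF p_density p_lower] c_pos by auto
  define S where "S = Lip f + Lip1 h + Lip2 h"
  have S0: "0 \<le> S" using nonneg by (simp add: S_def)
  \<comment> \<open>The threshold \<open>sqrt 3 / 2\<close> lies below 1, so the geometric series of
    the errors converges.\<close>
  have "sqrt 3 \<le> sqrt (2\<^sup>2)" by (rule real_sqrt_le_mono) simp
  then have \<kappa>1: "\<kappa> < 1" using kappa_less by simp
  have \<kappa>0: "0 \<le> \<kappa>" using c S0 by (simp add: kappa S_def)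
  have sq: "1 / sqrt (real N) = real N powr (- 1 / 2)" for N
    by (simp add: powr_minus_divide powr_half_sqrt)
  define D where "D = ((Lip2 h)\<^sup>2 + 1) / 2"
  have D: "0 < D" using zero_le_power2[of "Lip2 h"] by (simp add: D_def add_nonneg_pos)
  have DN: "((Lip2 h)\<^sup>2 + 1) / (2 * sqrt (real N)) = D * real N powr (- 1 / 2)" for N
    unfolding D_def sq[symmetric] by simp
  \<comment> \<open>The sum of that series: \<open>D\<close> is the error of one step without its
    factor \<open>N powr (- 1 / 2)\<close>.\<close>
  define C where "C = D / (1 - \<kappa>)"
  have C: "0 < C" using D \<kappa>1 by (simp add: C_def)
  have part1: "W1 N ((transfer_N f h p N ^^ n) \<mu>)
      (power_measure ((transfer_self_consistent f h p ^^ n) (first_marginal \<mu>)) N)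
    \<le> \<kappa> ^ n * W1 N \<mu> (power_measure (first_marginal \<mu>) N) + C * real N powr (- 1 / 2)"
    if "2 \<le> N" "\<mu> \<in> space (prob_algebra (torus N))" for N \<mu> n
    using W1_iterates_le[OF c, folded kappa, OF \<kappa>1 that(2) first_marginal_prob[OF that(2)], of n] that(1)
    by (simp add: DN C_def)
  have part2: "\<exists>C0 > 0. \<exists>C1 > 0. \<forall>N \<ge> 2. N \<ge> k \<longrightarrow>
        (\<forall>\<mu> \<in> space (prob_algebra (torus N)). exchangeable N \<mu> \<longrightarrow>
          (\<forall>n \<ge> 1. tv_norm_diff
                (marginal k ((transfer_N f h p N ^^ n) \<mu>))
                (power_measure ((transfer_self_consistent f h p ^^ n) (first_marginal \<mu>)) k)
              \<le> C0 * \<kappa> ^ (n - 1) * W1 N \<mu> (power_measure (first_marginal \<mu>) N)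
                + C1 * real N powr (- 1 / 2)))"
    if bv: "bv_circle p" and k: "1 \<le> k" for k
  proof -
    obtain V where V: "\<And>(n::nat) (t::nat \<Rightarrow> real). mono_on {..n} t \<Longrightarrow> t ` {..n} \<subseteq> {0..1} \<Longrightarrow>
        (\<Sum>i<n. \<bar>p (t (Suc i)) - p (t i)\<bar>) \<le> V"
      using bv unfolding bv_circle_def by blast
    have V0: "0 \<le> V" using V[of 0 "\<lambda>_. 0"] by (simp add: mono_on_def)
    define A where "A = real k * (4 * V + 2)"
    have A: "0 < A" using k V0 by (simp add: A_def add_nonneg_pos)
    have main: "tv_norm_diff
          (marginal k ((transfer_N f h p N ^^ n) \<mu>))
          (power_measure ((transfer_self_consistent f h p ^^ n) (first_marginal \<mu>)) k)
        \<le> (A * S + 1) * \<kappa> ^ (n - 1) * W1 N \<mu> (power_measure (first_marginal \<mu>) N)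
          + A * (S * C + D) * real N powr (- 1 / 2)"
      if N: "2 \<le> N" "k \<le> N" and \<mu>: "\<mu> \<in> space (prob_algebra (torus N))" and n: "1 \<le> n" for N \<mu> n
    proof -
      \<comment> \<open>The first \<open>m = n - 1\<close> steps are estimated in \<open>W1\<close>
        and only the last one in total variation, whence the exponent \<open>n - 1\<close>.\<close>
      obtain m where m: "n = Suc m" using n by (cases n) auto
      let ?\<mu> = "(transfer_N f h p N ^^ m) \<mu>"
        and ?\<nu> = "(transfer_self_consistent f h p ^^ m) (first_marginal \<mu>)"
      have \<nu>: "first_marginal \<mu> \<in> space (prob_algebra borel)"
        using N by (intro first_marginal_prob[OF \<mu>]) auto
      let ?W = "W1 N \<mu> (power_measure (first_marginal \<mu>) N)" and ?r = "real N powr (- 1 / 2)"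
      have W0: "0 \<le> ?W" by (intro W1_nonneg \<mu> power_measure_prob \<nu>)
      have "tv_norm_diff (marginal k (transfer_N f h p N ?\<mu>))
            (power_measure (transfer_self_consistent f h p ?\<nu>) k)
          \<le> A * (S * W1 N ?\<mu> (power_measure ?\<nu> N) + D * ?r)"
        unfolding A_def S_def DN[symmetric] using N by (intro tv_one_step V iterate_probs[OF \<mu> \<nu>]) auto
      also have "\<dots> \<le> A * (S * (\<kappa> ^ m * ?W + C * ?r) + D * ?r)"
        using part1[OF N(1) \<mu>, of m] S0 A by (intro mult_left_mono add_right_mono) auto
      also have "\<dots> = A * S * \<kappa> ^ m * ?W + A * (S * C + D) * ?r"
        by (simp add: algebra_simps)
      \<comment> \<open>The added 1 keeps the constant positive when \<open>S = 0\<close>, that is,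
        for constant \<open>f\<close> and \<open>h\<close>.\<close>
      also have "\<dots> \<le> (A * S + 1) * \<kappa> ^ m * ?W + A * (S * C + D) * ?r"
        using W0 \<kappa>0 by (simp add: algebra_simps)
      finally show ?thesis by (simp add: m)
    qed
    show ?thesis
      using A S0 C D main
      by (intro exI[of _ "A * S + 1"] conjI exI[of _ "A * (S * C + D)"])
         (auto intro!: mult_pos_pos add_nonneg_pos mult_nonneg_nonneg)
  qed
  show ?thesis using part1 part2 C by blast
qed

end
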